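(* Let $C$ be a smooth complete algebraic curve over $\mathbb{C}$ with function field $K$. Let $p\in C$, let $x\in K$ be a local parameter at $p$, and let $f\in K$ be a rational function such that $f\notin\mathbb{C}[x]$ and $v_p(f)=0$. In the completion of the local ring at $p$ write (uniquely) \[ f=\sum_{n=0}^\infty \alpha_n x^{a_n}, \] where $\alpha_n\in\mathbb{C}$, $\alpha_n\neq 0$ for all $n$, and $\{a_n\}_{n\ge 0}$ is a strictly increasing sequence of integers with $a_0=0$. Then \[ \limsup_{n\to\infty}\frac{a_n}{n}\leq \#S_1+\sum_{q\in S_2}\left(v_q\left(\frac{dx}{dx_q}\right)+1\right), \] where \[ S_1=\{q\in C : v_q(f)<0 \text{ and } v_q(dx/dx_q)=0\},\qquad S_2=\{q\in C : v_q(x)=0 \text{ and } v_q(dx/dx_q)>0\}, \] and, for each $q\in C$, $x_q$ is a local parameter at $q$.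
   Context: $C$ is a smooth complete algebraic curve (irreducible, as usual) over $\mathbb{C}$ and $K$ is its function field. For each (closed) point $q\in C$, $v_q:K^\times\to\mathbb{Z}$ is the unique surjective discrete valuation at $q$ (order of vanishing at $q$), with $v_q(0)=+\infty$. A local parameter at $q$ is an element $x_q\in K$ with $v_q(x_q)=1$. For nonconstant $y\in K$, $d/dy$ denotes the unique $\mathbb{C}$-linear derivation of $K$ with $dy/dy=1$; thus $dx/dx_q\in K$ is the ratio of the differentials $dx$ and $dx_q$, and $v_q(dx/dx_q)$ does not depend on the choice of local parameter $x_q$ at $q$. *)

theory Defs
  imports
    Complex_Main
    "HOL-Computational_Algebra.Polynomial"
    "HOL-Library.Extended_Real"
    "HOL-Library.Liminf_Limsup"
begin

text \<open>
  Algebraic curves are treated in the language of models of a function field (Chevalley, Zariski,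
  Nagata): \<open>K\<close> is a field containing the complex numbers, here a type \<open>'k\<close> with an embedding
  \<open>\<iota>\<close> of \<^typ>\<open>complex\<close>; a (closed) point is identified with its local ring, a subring of \<open>K\<close>;
  and a variety with function field \<open>K\<close> is a set of such local rings that is a finite union of
  affine varieties and is separated. Smoothness, separatedness and completeness are
  regularity of the local rings and the two valuative criteria. Irreducibility and
  reducedness are built in, since all charts have the same function field \<open>K\<close>.
\<close>

definition complex_embedding :: "(complex \<Rightarrow> 'k::field) \<Rightarrow> bool" where
  "complex_embedding \<iota> \<longleftrightarrow>
     \<iota> 1 = 1 \<and> (\<forall>a b. \<iota> (a + b) = \<iota> a + \<iota> b) \<and> (\<forall>a b. \<iota> (a * b) = \<iota> a * \<iota> b)"

text \<open>Value of a two-variable polynomial, given as a polynomial in \<open>Z\<close> over \<open>\<complex>[Y]\<close>, at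
  \<open>Y = y\<close>, \<open>Z = z\<close>.\<close>
definition eval2 :: "(complex \<Rightarrow> 'k::field) \<Rightarrow> complex poly poly \<Rightarrow> 'k \<Rightarrow> 'k \<Rightarrow> 'k" where
  "eval2 \<iota> P y z = poly (map_poly (\<lambda>c. poly (map_poly \<iota> c) y) P) z"

text \<open>Some element is transcendental over \<open>\<complex>\<close>, and no two elements are algebraically
  independent.\<close>
definition transcendence_degree_one :: "(complex \<Rightarrow> 'k::field) \<Rightarrow> bool" where
  "transcendence_degree_one \<iota> \<longleftrightarrow>
     (\<exists>y. \<forall>P. P \<noteq> 0 \<longrightarrow> poly (map_poly \<iota> P) y \<noteq> 0) \<and>
     (\<forall>y z. \<exists>P. P \<noteq> 0 \<and> eval2 \<iota> P y z = 0)"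

definition subalgebra :: "(complex \<Rightarrow> 'k::field) \<Rightarrow> 'k set \<Rightarrow> bool" where
  "subalgebra \<iota> A \<longleftrightarrow>
     range \<iota> \<subseteq> A \<and> (\<forall>a\<in>A. \<forall>b\<in>A. a + b \<in> A) \<and> (\<forall>a\<in>A. \<forall>b\<in>A. a * b \<in> A)"

text \<open>The subalgebra \<open>\<complex>[S]\<close> generated by \<open>S\<close>.\<close>
definition generated_algebra :: "(complex \<Rightarrow> 'k::field) \<Rightarrow> 'k set \<Rightarrow> 'k set" where
  "generated_algebra \<iota> S = \<Inter>{A. subalgebra \<iota> A \<and> S \<subseteq> A}"

definition is_ideal :: "'k::field set \<Rightarrow> 'k set \<Rightarrow> bool" where
  "is_ideal A I \<longleftrightarrow>
     I \<subseteq> A \<and> 0 \<in> I \<and> (\<forall>a\<in>I. \<forall>b\<in>I. a + b \<in> I) \<and> (\<forall>a\<in>A. \<forall>b\<in>I. a * b \<in> I)"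

definition maximal_ideal :: "'k::field set \<Rightarrow> 'k set \<Rightarrow> bool" where
  "maximal_ideal A M \<longleftrightarrow>
     is_ideal A M \<and> M \<noteq> A \<and> (\<forall>J. is_ideal A J \<and> M \<subseteq> J \<longrightarrow> J = M \<or> J = A)"

definition localization :: "'k::field set \<Rightarrow> 'k set \<Rightarrow> 'k set" where
  "localization A M = {a / b | a b. a \<in> A \<and> b \<in> A - M}"

text \<open>Coordinate ring of an affine variety with function field \<open>K\<close>: a finitely generated
  \<open>\<complex>\<close>-algebra with field of fractions \<open>K\<close>.\<close>
definition affine_coordinate_ring :: "(complex \<Rightarrow> 'k::field) \<Rightarrow> 'k set \<Rightarrow> bool" where
  "affine_coordinate_ring \<iota> A \<longleftrightarrow>
     (\<exists>S. finite S \<and> A = generated_algebra \<iota> S) \<and>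
     (\<forall>g. \<exists>a\<in>A. \<exists>b\<in>A. b \<noteq> 0 \<and> g = a / b)"

definition affine_points :: "'k::field set \<Rightarrow> 'k set set" where
  "affine_points A = {localization A M | M. maximal_ideal A M}"

text \<open>The non-units; this is the maximal ideal when \<open>R\<close> is a local ring.\<close>
definition nonunits :: "'k::field set \<Rightarrow> 'k set" where
  "nonunits R = {g \<in> R. g = 0 \<or> inverse g \<notin> R}"

definition valuation_ring :: "(complex \<Rightarrow> 'k::field) \<Rightarrow> 'k set \<Rightarrow> bool" where
  "valuation_ring \<iota> V \<longleftrightarrow> subalgebra \<iota> V \<and> (\<forall>g. g \<noteq> 0 \<longrightarrow> g \<in> V \<or> inverse g \<in> V)"

definition dominates :: "'k::field set \<Rightarrow> 'k set \<Rightarrow> bool" where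
  "dominates V R \<longleftrightarrow> R \<subseteq> V \<and> nonunits R \<subseteq> nonunits V"

definition separated :: "(complex \<Rightarrow> 'k::field) \<Rightarrow> 'k set set \<Rightarrow> bool" where
  "separated \<iota> C \<longleftrightarrow>
     (\<forall>V. \<forall>q\<in>C. \<forall>r\<in>C. valuation_ring \<iota> V \<and> dominates V q \<and> dominates V r \<longrightarrow> q = r)"

text \<open>The trivial valuation ring \<open>K\<close> is left out because only closed points, not the generic
  point, are members of \<open>C\<close>.\<close>
definition complete_variety :: "(complex \<Rightarrow> 'k::field) \<Rightarrow> 'k set set \<Rightarrow> bool" where
  "complete_variety \<iota> C \<longleftrightarrow>
     (\<forall>V. valuation_ring \<iota> V \<and> V \<noteq> UNIV \<longrightarrow> (\<exists>q\<in>C. dominates V q))"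

definition algebraic_curve :: "(complex \<Rightarrow> 'k::field) \<Rightarrow> 'k set set \<Rightarrow> bool" where
  "algebraic_curve \<iota> C \<longleftrightarrow>
     complex_embedding \<iota> \<and> transcendence_degree_one \<iota> \<and>
     (\<exists>\<A>. finite \<A> \<and> \<A> \<noteq> {} \<and> (\<forall>A\<in>\<A>. affine_coordinate_ring \<iota> A) \<and>
          C = (\<Union>A\<in>\<A>. affine_points A)) \<and>
     separated \<iota> C"

text \<open>Regularity of a one-dimensional local ring: the maximal ideal is generated by one
  element.\<close>
definition smooth_curve :: "'k::field set set \<Rightarrow> bool" where
  "smooth_curve C \<longleftrightarrow> (\<forall>q\<in>C. \<exists>t\<in>q. t \<noteq> 0 \<and> nonunits q = {t * g | g. g \<in> q})"

definition smooth_complete_curve :: "(complex \<Rightarrow> 'k::field) \<Rightarrow> 'k set set \<Rightarrow> bool" where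
  "smooth_complete_curve \<iota> C \<longleftrightarrow>
     algebraic_curve \<iota> C \<and> smooth_curve C \<and> complete_variety \<iota> C"

text \<open>Surjective discrete valuations \<open>K\<^sup>\<times> \<rightarrow> \<int>\<close>, extended by the value \<open>\<infinity>\<close> at 0.\<close>
definition discrete_valuation :: "('k::field \<Rightarrow> ereal) \<Rightarrow> bool" where
  "discrete_valuation v \<longleftrightarrow>
     v 0 = \<infinity> \<and> v ` (UNIV - {0}) = range (\<lambda>n::int. ereal (of_int n)) \<and>
     (\<forall>g h. v (g * h) = v g + v h) \<and> (\<forall>g h. min (v g) (v h) \<le> v (g + h))"

text \<open>The discrete valuation \<open>v\<^sub>q\<close> at the point with local ring \<open>q\<close>.\<close>
definition val_at :: "'k::field set \<Rightarrow> 'k \<Rightarrow> ereal" where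
  "val_at q = (THE v. discrete_valuation v \<and> {g. 0 \<le> v g} = q)"

definition local_parameter :: "'k::field set \<Rightarrow> 'k \<Rightarrow> bool" where
  "local_parameter q t \<longleftrightarrow> val_at q t = 1"

definition complex_derivation :: "(complex \<Rightarrow> 'k::field) \<Rightarrow> ('k \<Rightarrow> 'k) \<Rightarrow> bool" where
  "complex_derivation \<iota> D \<longleftrightarrow>
     (\<forall>g h. D (g + h) = D g + D h) \<and> (\<forall>c g. D (\<iota> c * g) = \<iota> c * D g) \<and>
     (\<forall>g h. D (g * h) = D g * h + g * D h)"

text \<open>\<open>ddx \<iota> y\<close> is the derivation \<open>d/dy\<close>, so \<open>ddx \<iota> y g\<close> is \<open>dg/dy\<close>.\<close>
definition ddx :: "(complex \<Rightarrow> 'k::field) \<Rightarrow> 'k \<Rightarrow> 'k \<Rightarrow> 'k" where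
  "ddx \<iota> y = (THE D. complex_derivation \<iota> D \<and> D y = 1)"

text \<open>\<open>f = (\<Sum>n. u n)\<close> in the completion of the local ring \<open>q\<close>. As \<open>q\<close> embeds in its completion
  and carries the induced topology, for \<open>f\<close> and \<open>u n\<close> in \<open>q\<close> this says that the partial sums
  tend to \<open>f\<close> in the topology of the powers \<open>{g. M \<le> v\<^sub>q g}\<close> of the maximal ideal.\<close>
definition sums_in_completion :: "'k::field set \<Rightarrow> (nat \<Rightarrow> 'k) \<Rightarrow> 'k \<Rightarrow> bool" where
  "sums_in_completion q u f \<longleftrightarrow>
     (\<lambda>N. val_at q (f - (\<Sum>n<N. u n))) \<longlonglongrightarrow> \<infinity>"

end

theory Submission
  imports Defs
    "HOL-Computational_Algebra.Formal_Laurent_Series"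
    "HOL-Computational_Algebra.Fundamental_Theorem_Algebra"
    "HOL-Library.Multiset"
begin

text \<open>
  Let \<open>\<theta> = x d/dx\<close>. As \<open>\<theta> x\<^sup>k = k x\<^sup>k\<close>, the operator \<open>(\<theta> - a\<^sub>0) \<cdots> (\<theta> - a\<^sub>n\<^sub>-\<^sub>1)\<close> removes the first \<open>n\<close> terms
  from the expansion of \<open>f\<close> at \<open>p\<close> and only multiplies the others by nonzero constants, so it
  sends \<open>f\<close> to a function \<open>g\<^sub>n\<close> with a zero of order exactly \<open>a\<^sub>n\<close> at \<open>p\<close>
  (\<open>euler_product_order\<close>). The poles of \<open>g\<^sub>n\<close> are controlled locally: \<open>\<theta>\<close> creates no pole where
  \<open>v\<^sub>q(x) \<noteq> 0\<close>, and where \<open>v\<^sub>q(x) = 0\<close> it increases a pole by at most \<open>v\<^sub>q(dx/dx\<^sub>q) + 1\<close>, with no pole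
  created if \<open>f\<close> is regular and \<open>x\<close> is unramified (\<open>euler_product_poles\<close>). Hence \<open>g\<^sub>n\<close> has at most
  \<open>B + n W\<close> poles, counted with multiplicity, where \<open>B\<close> is the number of poles of \<open>f\<close> and \<open>W\<close> the right-hand side of
  the bound. The order of a zero is at most the number of poles (\<open>order_le_poles\<close>), so
  \<open>a\<^sub>n \<le> B + n W\<close>.

  The rest supplies the theory of curves that this uses. At a regular point, transcendence degree
  one alone gives residue field \<open>\<complex>\<close> and expansions in a local parameter, that is, an embedding of
  \<open>K\<close> into the field of Laurent series that carries the valuation to the order of a series; formal
  differentiation preserves \<open>K\<close>, which constructs \<open>d/dx\<close> (\<open>ddx_derivation\<close>). Finiteness of zeros,
  poles and ramification comes from the finite generation of the charts (\<open>finite_zeros_affine\<close>,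
  \<open>finite_irregular_derivation\<close>). Completeness enters through the fact that an everywhere
  regular function is constant (\<open>regular_everywhere_imp_const\<close>), which needs a valuation ring
  avoiding a given nonconstant element. It gives \<open>dim L(D) \<le> deg D + 1\<close>, stated for the
  orders of functions at \<open>p\<close> (\<open>card_rr_orders\<close>), and this inequality, applied to the multiples \<open>k D\<close> of the
  divisor \<open>D\<close> of poles of \<open>g\<close> and to the functions \<open>g\<^sup>j t\<^sup>i\<close>, bounds the zeros of \<open>g\<close> by its
  poles (\<open>order_le_degree\<close>).
\<close>

unbundle fps_syntax

section \<open>Polynomial relations over the complex numbers\<close>

text \<open>A field \<open>K\<close> over \<open>\<complex>\<close> of transcendence degree at most one. Only the dependence of any two
  elements is required; that \<open>K\<close> is finitely generated enters later, through affine charts.\<close>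
locale function_field =
  fixes \<iota> :: "complex \<Rightarrow> 'k::field"
  assumes embedding: "complex_embedding \<iota>"
    and algebraic_dependence: "\<exists>P. P \<noteq> 0 \<and> eval2 \<iota> P y z = 0"
begin

lemma \<iota>_1 [simp]: "\<iota> 1 = 1"
  and \<iota>_add [simp]: "\<iota> (a + b) = \<iota> a + \<iota> b"
  and \<iota>_mult [simp]: "\<iota> (a * b) = \<iota> a * \<iota> b"
  using embedding by (auto simp: complex_embedding_def)

lemma \<iota>_0 [simp]: "\<iota> 0 = 0"
  using \<iota>_add[of 0 0] by (metis add_0 add_cancel_right_right)

lemma \<iota>_uminus [simp]: "\<iota> (- a) = - \<iota> a"
  using \<iota>_add[of a "- a"] by (simp add: eq_neg_iff_add_eq_0 add.commute del: \<iota>_add)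

lemma \<iota>_diff [simp]: "\<iota> (a - b) = \<iota> a - \<iota> b"
  using \<iota>_add[of a "- b"] by simp

lemma \<iota>_eq_0_iff [simp]: "\<iota> a = 0 \<longleftrightarrow> a = 0"
  using \<iota>_mult[of a "inverse a"] by (cases "a = 0") auto

text \<open>The value \<open>P(y)\<close> of a complex polynomial at an element of \<open>K\<close>.\<close>
definition peval :: "complex poly \<Rightarrow> 'k \<Rightarrow> 'k" where
  "peval P y = poly (map_poly \<iota> P) y"

lemma peval_0 [simp]: "peval 0 y = 0"
  by (simp add: peval_def)

lemma peval_pCons [simp]: "peval (pCons a P) y = \<iota> a + y * peval P y"
  by (simp add: peval_def map_poly_pCons)

lemma peval_add [simp]: "peval (P + Q) y = peval P y + peval Q y"
proof (induction P arbitrary: Q)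
  case (pCons a P)
  show ?case using pCons(2) by (cases Q) (simp add: algebra_simps)
qed simp

lemma peval_smult [simp]: "peval (smult c P) y = \<iota> c * peval P y"
  by (induction P) (simp_all add: algebra_simps)

lemma peval_mult [simp]: "peval (P * Q) y = peval P y * peval Q y"
  by (induction P) (simp_all add: algebra_simps)

lemma peval_monom [simp]: "peval (monom c n) y = \<iota> c * y ^ n"
  by (induction n) (simp_all add: monom_0 monom_Suc)

lemma eval2_0 [simp]: "eval2 \<iota> 0 y z = 0"
  by (simp add: eval2_def)

lemma eval2_pCons [simp]: "eval2 \<iota> (pCons p P) y z = peval p y + z * eval2 \<iota> P y z"
  by (simp add: eval2_def map_poly_pCons peval_def)

lemma eval2_add [simp]: "eval2 \<iota> (P + Q) y z = eval2 \<iota> P y z + eval2 \<iota> Q y z"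
proof (induction P arbitrary: Q)
  case (pCons a P)
  show ?case using pCons(2) by (cases Q) (simp add: algebra_simps)
qed simp

lemma eval2_smult [simp]: "eval2 \<iota> (smult p P) y z = peval p y * eval2 \<iota> P y z"
  by (induction P) (simp_all add: algebra_simps)

text \<open>As \<open>\<complex>\<close> is algebraically closed, \<open>P(z)\<close> splits into linear factors \<open>z - c\<close>. With \<open>I = {0}\<close> this
  says that algebraic elements are constants; with \<open>I\<close> the maximal ideal of a local ring it
  computes residues.\<close>
lemma peval_in_prime_imp_root:
  assumes "P \<noteq> 0" "peval P z \<in> I"
    and R: "\<And>Q. peval Q z \<in> R"
    and const: "\<And>c. c \<noteq> 0 \<Longrightarrow> \<iota> c \<notin> I"
    and prime: "\<And>a b. a \<in> R \<Longrightarrow> b \<in> R \<Longrightarrow> a * b \<in> I \<Longrightarrow> a \<in> I \<or> b \<in> I"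
  shows "\<exists>c. z - \<iota> c \<in> I \<and> poly P c = 0"
  using assms(1,2)
proof (induction "degree P" arbitrary: P)
  case 0
  then obtain c where "P = [:c:]" by (metis degree_eq_zeroE)
  with 0 const show ?case by (auto)
next
  case (Suc n)
  then obtain c where c: "poly P c = 0"
    using alg_closed_imp_poly_has_root[of P] by auto
  then obtain Q where Q: "P = [:- c, 1:] * Q"
    by (metis dvdE poly_eq_0_iff_dvd)
  have "Q \<noteq> 0" using Suc.prems Q by auto
  moreover have "degree P = Suc (degree Q)"
    unfolding Q using \<open>Q \<noteq> 0\<close> by (subst degree_mult_eq) auto
  ultimately have "Q \<noteq> 0" "degree Q = n" using Suc.hyps(2) by auto
  have "peval [:- c, 1:] z * peval Q z \<in> I"
    using Suc.prems by (simp only: Q peval_mult)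
  hence "peval [:- c, 1:] z \<in> I \<or> peval Q z \<in> I"
    using prime R by blast
  thus ?case
  proof
    assume "peval [:- c, 1:] z \<in> I"
    thus ?thesis using c by auto
  next
    assume "peval Q z \<in> I"
    with Suc.hyps(1)[of Q] \<open>Q \<noteq> 0\<close> \<open>degree Q = n\<close> show ?thesis by (auto simp: Q)
  qed
qed

lemma algebraic_imp_const:
  assumes "P \<noteq> 0" "peval P z = 0"
  shows "z \<in> range \<iota>"
  using peval_in_prime_imp_root[of P z "{0}" UNIV] assms by auto

text \<open>Dividing an algebraic relation \<open>P(y, z) = 0\<close> by the powers of \<open>Y\<close> in \<open>P\<close> makes \<open>P(0, Z)\<close>
  nonzero. Together with the next lemma this replaces Noetherian arguments: it turns the relation
  into a nonzero complex polynomial whose value at \<open>z\<close> is a multiple of \<open>y\<close>.\<close>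
lemma reduced_dependence:
  assumes "y \<noteq> 0"
  obtains P where "eval2 \<iota> P y z = 0" "map_poly (\<lambda>p. coeff p 0) P \<noteq> 0"
proof -
  obtain P where "P \<noteq> 0" "eval2 \<iota> P y z = 0"
    using algebraic_dependence by blast
  hence "\<exists>P. eval2 \<iota> P y z = 0 \<and> map_poly (\<lambda>p. coeff p 0) P \<noteq> 0"
  proof (induction "degree (lead_coeff P)" arbitrary: P rule: less_induct)
    case less
    show ?case
    proof (cases "map_poly (\<lambda>p. coeff p 0) P = 0")
      case True
      have dvd: "[:0, 1:] dvd coeff P i" for i
      proof -
        have "coeff (coeff P i) 0 = 0"
          using arg_cong[OF True, of "\<lambda>p. coeff p i"] by (simp add: coeff_map_poly)
        thus ?thesis using poly_eq_0_iff_dvd[of "coeff P i" 0] by (simp add: poly_0_coeff_0)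
      qed
      hence "[:[:0, 1:]:] dvd P"
        using const_poly_dvd_iff by blast
      then obtain Q where "P = [:[:0, 1:]:] * Q" by (elim dvdE)
      hence Q: "P = smult [:0, 1:] Q" by simp
      have "Q \<noteq> 0" using less.prems Q by auto
      moreover have "eval2 \<iota> Q y z = 0"
        using less.prems assms by (auto simp: Q)
      moreover have "degree (lead_coeff Q) < degree (lead_coeff P)"
        using \<open>Q \<noteq> 0\<close> by (simp add: Q)
      ultimately show ?thesis using less.hyps by blast
    qed (use less in blast)
  qed
  thus thesis using that by blast
qed

lemma eval2_reduce:
  assumes R: "subalgebra \<iota> R" "y \<in> R" "z \<in> R"
  shows "\<exists>r\<in>R. eval2 \<iota> P y z = peval (map_poly (\<lambda>p. coeff p 0) P) z + y * r"
proof (induction P)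
  case 0
  have "\<iota> 0 \<in> R" using R by (auto simp: subalgebra_def simp del: \<iota>_0)
  thus ?case by (auto intro!: bexI[of _ 0])
next
  case (pCons p P)
  then obtain r where r: "r \<in> R" "eval2 \<iota> P y z = peval (map_poly (\<lambda>p. coeff p 0) P) z + y * r"
    by blast
  have pe: "peval Q y \<in> R" for Q
    using R by (induction Q) (auto simp: subalgebra_def range_subsetD simp del: \<iota>_0 simp flip: \<iota>_0)
  obtain a q where p: "p = pCons a q" by (cases p)
  have "peval q y + z * r \<in> R" using pe R r by (auto simp: subalgebra_def)
  thus ?case using r by (auto intro!: bexI[of _ "peval q y + z * r"] simp: map_poly_pCons p algebra_simps)
qed

text \<open>A relation of minimal degree in \<open>Z\<close> is separable, the characteristic being zero.\<close>
lemma separable_dependence: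
  assumes "y \<notin> range \<iota>"
  obtains P where "eval2 \<iota> P y z = 0" "eval2 \<iota> (pderiv P) y z \<noteq> 0"
proof -
  define d where "d = (LEAST d. \<exists>P. P \<noteq> 0 \<and> eval2 \<iota> P y z = 0 \<and> degree P = d)"
  have "\<exists>d P. P \<noteq> 0 \<and> eval2 \<iota> P y z = 0 \<and> degree P = d"
    using algebraic_dependence by blast
  hence "\<exists>P. P \<noteq> 0 \<and> eval2 \<iota> P y z = 0 \<and> degree P = d"
    unfolding d_def by (rule LeastI_ex)
  then obtain P where P: "P \<noteq> 0" "eval2 \<iota> P y z = 0" "degree P = d" by blast
  have "degree P \<noteq> 0"
  proof
    assume "degree P = 0"
    then obtain p where p: "P = [:p:]" by (metis degree_eq_zeroE)
    hence "peval p y = 0" "p \<noteq> 0" using P by auto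
    thus False using algebraic_imp_const assms by blast
  qed
  have "eval2 \<iota> (pderiv P) y z \<noteq> 0"
  proof
    assume "eval2 \<iota> (pderiv P) y z = 0"
    moreover have "pderiv P \<noteq> 0" using \<open>degree P \<noteq> 0\<close> by (simp add: pderiv_eq_0_iff)
    ultimately have "d \<le> degree (pderiv P)"
      unfolding d_def by (intro Least_le) blast
    thus False using P \<open>degree P \<noteq> 0\<close> by (simp add: degree_pderiv)
  qed
  thus thesis using that P by blast
qed

end

text \<open>A \<open>\<complex>\<close>-linear derivation along a ring homomorphism obeys the chain rule for
  two-variable polynomials.\<close>
lemma (in function_field) derivation_eval2:
  fixes E \<delta> :: "'k \<Rightarrow> 'l::field"
  assumes E: "\<And>a b. E (a + b) = E a + E b" "\<And>a b. E (a * b) = E a * E b"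
    and \<delta>: "\<And>a b. \<delta> (a + b) = \<delta> a + \<delta> b" "\<And>a b. \<delta> (a * b) = \<delta> a * E b + E a * \<delta> b"
      "\<And>c. \<delta> (\<iota> c) = 0"
  shows "\<delta> (eval2 \<iota> P y z) =
    E (eval2 \<iota> (map_poly pderiv P) y z) * \<delta> y + E (eval2 \<iota> (pderiv P) y z) * \<delta> z"
proof -
  have E0: "E 0 = 0" using E(1)[of 0 0] by (metis add_0 add_cancel_right_right)
  have \<delta>0: "\<delta> 0 = 0" using \<delta>(1)[of 0 0] by (metis add_0 add_cancel_right_right)
  have *: "\<delta> (peval p y) = E (peval (pderiv p) y) * \<delta> y" for p
    by (induction p) (simp_all add: \<delta>0 E0 \<delta> E pderiv_pCons algebra_simps)
  show ?thesis
    by (induction P) (simp_all add: \<delta>0 E0 \<delta> E * pderiv_pCons map_poly_pCons algebra_simps)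
qed

section \<open>Power series expansions at a regular point\<close>

text \<open>A one-dimensional regular local ring \<open>R\<close> of \<open>K\<close> with uniformizer \<open>t\<close>. No Noetherian hypothesis
  is made: that \<open>R\<close> is a discrete valuation ring with residue field \<open>\<complex>\<close> is proved below.\<close>
locale regular_point = function_field +
  fixes R :: "'a set" and t :: 'a
  assumes subalgebra: "subalgebra \<iota> R"
    and fractions: "\<exists>a\<in>R. \<exists>b\<in>R. b \<noteq> 0 \<and> g = a / b"
    and t_nonzero: "t \<noteq> 0"
    and nonunits_eq: "nonunits R = {t * g | g. g \<in> R}"
begin

lemma R_const [simp]: "\<iota> c \<in> R"
  and R_add: "a \<in> R \<Longrightarrow> b \<in> R \<Longrightarrow> a + b \<in> R"
  and R_mult: "a \<in> R \<Longrightarrow> b \<in> R \<Longrightarrow> a * b \<in> R"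
  using subalgebra by (auto simp: subalgebra_def)

lemma R_0 [simp]: "0 \<in> R" and R_1 [simp]: "1 \<in> R"
  using R_const[of 0] R_const[of 1] by simp_all

lemma R_uminus: "a \<in> R \<Longrightarrow> - a \<in> R"
  using R_mult[OF R_const[of "- 1"]] by simp

lemma R_diff: "a \<in> R \<Longrightarrow> b \<in> R \<Longrightarrow> a - b \<in> R"
  using R_add[of a "- b"] R_uminus by simp

lemma R_power: "a \<in> R \<Longrightarrow> a ^ n \<in> R"
  by (induction n) (auto intro: R_mult)

lemma t_nonunit: "t \<in> nonunits R"
  unfolding nonunits_eq by (intro CollectI exI[of _ 1]) simp

lemma t_in_R [simp]: "t \<in> R"
  using t_nonunit by (simp add: nonunits_def)

lemma R_peval: "z \<in> R \<Longrightarrow> peval P z \<in> R"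
  by (induction P) (auto intro: R_add R_mult)

lemma const_unit: "c \<noteq> 0 \<Longrightarrow> \<iota> c \<notin> nonunits R"
proof -
  assume "c \<noteq> 0"
  have "\<iota> c * \<iota> (inverse c) = 1" using \<open>c \<noteq> 0\<close> by (simp flip: \<iota>_mult)
  hence "inverse (\<iota> c) = \<iota> (inverse c)" by (rule inverse_unique)
  thus ?thesis using \<open>c \<noteq> 0\<close> by (simp add: nonunits_def)
qed

lemma nonunits_prime: "a \<in> R \<Longrightarrow> b \<in> R \<Longrightarrow> a * b \<in> nonunits R \<Longrightarrow> a \<in> nonunits R \<or> b \<in> nonunits R"
  by (auto simp: nonunits_def R_mult)

text \<open>The residue field is \<open>\<complex>\<close>: by algebraic dependence of \<open>t\<close> and \<open>y\<close>, the residue class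
  of \<open>y\<close> is a root of a nonzero complex polynomial.\<close>
lemma residue_exists:
  assumes "y \<in> R"
  shows "\<exists>c g. g \<in> R \<and> y = \<iota> c + t * g"
proof -
  obtain P where P: "eval2 \<iota> P t y = 0" "map_poly (\<lambda>p. coeff p 0) P \<noteq> 0" (is "?P0 \<noteq> 0")
    using reduced_dependence[OF t_nonzero] by blast
  obtain r where "r \<in> R" "0 = peval ?P0 y + t * r"
    using eval2_reduce[OF subalgebra t_in_R assms, of P] P by auto
  hence "peval ?P0 y = t * (- r)" "- r \<in> R"
    by (auto simp: R_uminus eq_neg_iff_add_eq_0)
  hence "peval ?P0 y \<in> nonunits R"
    unfolding nonunits_eq by blast
  then obtain c where "y - \<iota> c \<in> nonunits R"
    using peval_in_prime_imp_root[OF P(2), of y "nonunits R" R] R_peval[OF assms]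
      const_unit nonunits_prime by blast
  then obtain g where "g \<in> R" "y - \<iota> c = t * g" by (auto simp: nonunits_eq)
  thus ?thesis by (metis add.commute diff_eq_eq)
qed

lemma peval_t_dvd_iff: "(\<exists>r\<in>R. peval P t = t ^ n * r) \<longleftrightarrow> (\<forall>i<n. coeff P i = 0)"
proof (induction n arbitrary: P)
  case 0
  have "peval P t \<in> R" by (intro R_peval t_in_R)
  thus ?case by simp
next
  case (Suc n)
  obtain a Q where P: "P = pCons a Q" by (cases P)
  have "(\<exists>r\<in>R. peval P t = t ^ Suc n * r) \<longleftrightarrow> a = 0 \<and> (\<exists>r\<in>R. peval Q t = t ^ n * r)" (is "?L \<longleftrightarrow> ?M")
  proof
    assume ?L
    then obtain r where r: "r \<in> R" "\<iota> a + t * peval Q t = t ^ Suc n * r" by (auto simp: P)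
    hence "\<iota> a = t * (t ^ n * r - peval Q t)" by (simp add: algebra_simps eq_diff_eq)
    moreover have "t ^ n * r - peval Q t \<in> R"
      using r by (intro R_diff R_mult R_power R_peval) auto
    ultimately have "\<iota> a \<in> nonunits R" by (auto simp: nonunits_eq)
    hence "a = 0" using const_unit by blast
    with r t_nonzero have "peval Q t = t ^ n * r" by simp
    with r \<open>a = 0\<close> show ?M by blast
  next
    assume ?M
    thus ?L by (auto simp: P)
  qed
  also have "\<dots> \<longleftrightarrow> (\<forall>i<Suc n. coeff P i = 0)"
    unfolding Suc.IH by (auto simp: P coeff_pCons less_Suc_eq_0_disj split: nat.splits)
  finally show ?case .
qed

text \<open>\<open>F\<close> is the expansion of \<open>y\<close> as a power series in \<open>t\<close>. Any polynomial that agrees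
  with \<open>F\<close> up to order \<open>n\<close> may serve as the \<open>n\<close>-th truncation.\<close>
definition expands :: "'a \<Rightarrow> complex fps \<Rightarrow> bool" where
  "expands y F \<longleftrightarrow>
     (\<forall>n. \<exists>P. \<exists>g\<in>R. (\<forall>i<n. coeff P i = F $ i) \<and> y = peval P t + t ^ n * g)"

lemma expandsE:
  assumes "expands y F"
  obtains P g where "g \<in> R" "\<And>i. i < n \<Longrightarrow> coeff P i = F $ i" "y = peval P t + t ^ n * g"
  using assms unfolding expands_def by blast

lemma expands_exists:
  assumes "y \<in> R"
  shows "\<exists>F. expands y F"
proof -
  have "\<exists>c g. \<forall>z\<in>R. g z \<in> R \<and> z = \<iota> (c z) + t * g z"
    using residue_exists by metis
  then obtain c g where cg: "\<And>z. z \<in> R \<Longrightarrow> g z \<in> R" "\<And>z. z \<in> R \<Longrightarrow> z = \<iota> (c z) + t * g z"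
    by blast
  define Y where "Y n = (g ^^ n) y" for n
  have Y: "Y n \<in> R" for n
    unfolding Y_def by (induction n) (auto intro: cg assms)
  have *: "y = peval (\<Sum>i<n. monom (c (Y i)) i) t + t ^ n * Y n" for n
  proof (induction n)
    case 0
    show ?case by (simp add: Y_def)
  next
    case (Suc n)
    have "Y n = \<iota> (c (Y n)) + t * Y (Suc n)"
      using cg(2)[OF Y, of n] by (simp add: Y_def)
    hence "t ^ n * Y n = t ^ n * (\<iota> (c (Y n)) + t * Y (Suc n))" by (rule arg_cong)
    hence "t ^ n * Y n = \<iota> (c (Y n)) * t ^ n + t ^ Suc n * Y (Suc n)"
      by (simp only: distrib_left mult_ac power_Suc)
    with Suc show ?case by (simp add: algebra_simps)
  qed
  have "expands y (Abs_fps (\<lambda>i. c (Y i)))"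
    unfolding expands_def
  proof (intro allI exI bexI conjI impI)
    fix n show "y = peval (\<Sum>i<n. monom (c (Y i)) i) t + t ^ n * Y n" by (rule *)
  qed (auto simp: coeff_sum Y)
  thus ?thesis by blast
qed

lemma expands_imp_in_R: "expands y F \<Longrightarrow> y \<in> R"
  by (erule expandsE[of _ _ 0]) (simp add: R_add R_peval)

lemma expands_dvd_iff:
  assumes "expands y F"
  shows "(\<exists>r\<in>R. y = t ^ n * r) \<longleftrightarrow> (\<forall>i<n. F $ i = 0)"
proof -
  obtain P g where P: "g \<in> R" "\<And>i. i < n \<Longrightarrow> coeff P i = F $ i" "y = peval P t + t ^ n * g"
    using expandsE[OF assms] by metis
  have "(\<exists>r\<in>R. y = t ^ n * r) \<longleftrightarrow> (\<exists>r\<in>R. peval P t = t ^ n * r)"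
  proof
    assume "\<exists>r\<in>R. y = t ^ n * r"
    then obtain r where "r \<in> R" "y = t ^ n * r" by blast
    with P show "\<exists>r\<in>R. peval P t = t ^ n * r"
      by (intro bexI[of _ "r - g"]) (auto simp: algebra_simps R_diff)
  next
    assume "\<exists>r\<in>R. peval P t = t ^ n * r"
    then obtain r where "r \<in> R" "peval P t = t ^ n * r" by blast
    with P show "\<exists>r\<in>R. y = t ^ n * r"
      by (intro bexI[of _ "r + g"]) (auto simp: algebra_simps R_add)
  qed
  also have "\<dots> \<longleftrightarrow> (\<forall>i<n. F $ i = 0)" using P(2) by (simp add: peval_t_dvd_iff)
  finally show ?thesis .
qed

lemma expands_add:
  assumes "expands y F" "expands z G"
  shows "expands (y + z) (F + G)"
  unfolding expands_def
proof
  fix n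
  obtain P g where P: "g \<in> R" "\<And>i. i < n \<Longrightarrow> coeff P i = F $ i" "y = peval P t + t ^ n * g"
    using expandsE[OF assms(1)] by metis
  obtain Q h where Q: "h \<in> R" "\<And>i. i < n \<Longrightarrow> coeff Q i = G $ i" "z = peval Q t + t ^ n * h"
    using expandsE[OF assms(2)] by metis
  show "\<exists>P. \<exists>g\<in>R. (\<forall>i<n. coeff P i = (F + G) $ i) \<and> y + z = peval P t + t ^ n * g"
    using P Q by (intro exI[of _ "P + Q"] bexI[of _ "g + h"]) (auto simp: R_add algebra_simps)
qed

lemma expands_mult:
  assumes "expands y F" "expands z G"
  shows "expands (y * z) (F * G)"
  unfolding expands_def
proof
  fix n
  obtain P g where P: "g \<in> R" "\<And>i. i < n \<Longrightarrow> coeff P i = F $ i" "y = peval P t + t ^ n * g"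
    using expandsE[OF assms(1)] by metis
  obtain Q h where Q: "h \<in> R" "\<And>i. i < n \<Longrightarrow> coeff Q i = G $ i" "z = peval Q t + t ^ n * h"
    using expandsE[OF assms(2)] by metis
  have "g * z + peval P t * h \<in> R"
    using P(1) Q(1) expands_imp_in_R[OF assms(2)] by (intro R_add R_mult R_peval) auto
  moreover have "y * z = peval (P * Q) t + t ^ n * (g * z + peval P t * h)"
    by (subst Q(3), subst P(3)) (simp add: Q(3) algebra_simps)
  moreover have "coeff (P * Q) i = (F * G) $ i" if "i < n" for i
    unfolding coeff_mult fps_mult_nth atMost_atLeast0
    using that P(2) Q(2) by (intro sum.cong) auto
  ultimately show "\<exists>P. \<exists>g\<in>R. (\<forall>i<n. coeff P i = (F * G) $ i) \<and> y * z = peval P t + t ^ n * g"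
    by blast
qed

lemma expands_const: "expands (\<iota> c) (fps_const c)"
  unfolding expands_def
  by (intro allI exI[of _ "[:c:]"] bexI[of _ 0]) (auto simp: coeff_pCons split: nat.splits)

lemma expands_t: "expands t fps_X"
  unfolding expands_def
  by (intro allI exI[of _ "[:0, 1:]"] bexI[of _ 0])
    (auto simp: coeff_pCons fps_X_def split: nat.splits)

lemma expands_unique:
  assumes "expands y F" "expands y G"
  shows "F = G"
proof (rule fps_ext)
  fix i
  have "expands (- y) (fps_const (- 1) * G)"
    using expands_mult[OF expands_const[of "- 1"] assms(2)] by simp
  from expands_add[OF assms(1) this] have "expands 0 (F + fps_const (- 1) * G)" by simp
  from expands_dvd_iff[OF this, of "Suc i"] have "(F + fps_const (- 1) * G) $ i = 0"
    by (metis R_0 lessI mult_zero_right)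
  thus "F $ i = G $ i" by simp
qed

text \<open>Krull's intersection theorem for \<open>R\<close>: an element divisible by all powers of \<open>t\<close>
  would divide a nonzero polynomial in \<open>t\<close>, by algebraic dependence.\<close>
lemma powers_intersect:
  assumes "y \<in> R" "\<And>n. \<exists>r\<in>R. y = t ^ n * r"
  shows "y = 0"
proof (rule ccontr)
  assume "y \<noteq> 0"
  obtain P where P: "eval2 \<iota> P y t = 0" "map_poly (\<lambda>p. coeff p 0) P \<noteq> 0" (is "?P0 \<noteq> 0")
    using reduced_dependence[OF \<open>y \<noteq> 0\<close>] by blast
  obtain r where r: "r \<in> R" "0 = peval ?P0 t + y * r"
    using eval2_reduce[OF subalgebra assms(1) t_in_R, of P] P by auto
  have "coeff ?P0 n = 0" for n
  proof -
    obtain s where "s \<in> R" "y = t ^ Suc n * s" using assms(2) by blast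
    with r have "peval ?P0 t = t ^ Suc n * (- (s * r))"
      by (simp add: eq_neg_iff_add_eq_0 mult.assoc)
    moreover have "- (s * r) \<in> R" using r \<open>s \<in> R\<close> by (intro R_uminus R_mult)
    ultimately show ?thesis using peval_t_dvd_iff[of ?P0 "Suc n"] by blast
  qed
  hence "?P0 = 0" by (intro poly_eqI) simp
  with P show False by simp
qed

lemma expands_0_imp_0: "expands y 0 \<Longrightarrow> y = 0"
  using expands_dvd_iff[of y 0] by (intro powers_intersect) (auto intro: expands_imp_in_R)

lemma unit_decomposition:
  assumes "expands y F" "y \<noteq> 0"
  obtains u where "y = t ^ subdegree F * u" "u \<in> R" "inverse u \<in> R" "u \<noteq> 0"
proof -
  have "F \<noteq> 0" using assms expands_0_imp_0 by blast
  obtain u where u: "u \<in> R" "y = t ^ subdegree F * u"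
    using expands_dvd_iff[OF assms(1), of "subdegree F"] by auto
  have "u \<notin> nonunits R"
  proof
    assume "u \<in> nonunits R"
    then obtain r where "r \<in> R" "u = t * r" by (auto simp: nonunits_eq)
    with u have "\<exists>r\<in>R. y = t ^ Suc (subdegree F) * r" by (auto simp: mult_ac)
    hence "F $ subdegree F = 0" using expands_dvd_iff[OF assms(1)] by blast
    thus False using \<open>F \<noteq> 0\<close> by simp
  qed
  with u that assms show thesis by (auto simp: nonunits_def)
qed

text \<open>The Taylor expansion in \<open>t\<close> of an element of \<open>R\<close>.\<close>
definition expansion :: "'a \<Rightarrow> complex fps" where
  "expansion y = (THE F. expands y F)"

lemma expands_expansion: "y \<in> R \<Longrightarrow> expands y (expansion y)"
  unfolding expansion_def
  by (rule theI') (use expands_exists[of y] expands_unique[of y] in blast)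

lemma expansion_eqI: "expands y F \<Longrightarrow> expansion y = F"
  using expands_unique[OF expands_expansion[OF expands_imp_in_R]] by blast

text \<open>The Laurent expansion of an arbitrary element of \<open>K\<close>, the quotient of the expansions of
  numerator and denominator; the choice of the fraction is immaterial.\<close>
definition laurent :: "'a \<Rightarrow> complex fls" where
  "laurent g = (SOME F. \<exists>a\<in>R. \<exists>b\<in>R. b \<noteq> 0 \<and> g = a / b \<and>
      F = fps_to_fls (expansion a) / fps_to_fls (expansion b))"

lemma expansion_eq_0_iff: "y \<in> R \<Longrightarrow> expansion y = 0 \<longleftrightarrow> y = 0"
  using expands_expansion[of y] expands_0_imp_0[of y] expansion_eqI[OF expands_const[of 0]] by auto

lemma laurent_fraction:
  assumes "a \<in> R" "b \<in> R" "b \<noteq> 0"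
  shows "laurent (a / b) = fps_to_fls (expansion a) / fps_to_fls (expansion b)"
  unfolding laurent_def
proof (rule someI2_ex)
  fix F assume "\<exists>c\<in>R. \<exists>d\<in>R. d \<noteq> 0 \<and> a / b = c / d \<and> F = fps_to_fls (expansion c) / fps_to_fls (expansion d)"
  then obtain c d where cd: "c \<in> R" "d \<in> R" "d \<noteq> 0" "a / b = c / d"
    "F = fps_to_fls (expansion c) / fps_to_fls (expansion d)" by blast
  hence "a * d = c * b" using assms by (simp add: field_simps)
  moreover have "expands (a * d) (expansion a * expansion d)"
    using assms cd by (intro expands_mult expands_expansion)
  moreover have "expands (c * b) (expansion c * expansion b)"
    using assms cd by (intro expands_mult expands_expansion)
  ultimately have "expansion a * expansion d = expansion c * expansion b"
    using expands_unique by metis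
  hence "fps_to_fls (expansion a) * fps_to_fls (expansion d) = fps_to_fls (expansion c) * fps_to_fls (expansion b)"
    by (simp flip: fls_times_fps_to_fls)
  thus "F = fps_to_fls (expansion a) / fps_to_fls (expansion b)"
    using assms cd by (simp add: frac_eq_eq expansion_eq_0_iff)
next
  show "\<exists>F. \<exists>c\<in>R. \<exists>d\<in>R. d \<noteq> 0 \<and> a / b = c / d \<and> F = fps_to_fls (expansion c) / fps_to_fls (expansion d)"
    by (rule exI, rule bexI, rule bexI, rule conjI, fact, rule conjI, rule refl, rule refl) fact+
qed

lemma laurent_R: "y \<in> R \<Longrightarrow> laurent y = fps_to_fls (expansion y)"
  using laurent_fraction[of y 1] expansion_eqI[OF expands_const[of 1]] by simp

lemma laurent_const: "laurent (\<iota> c) = fls_const c"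
  by (simp add: laurent_R expansion_eqI[OF expands_const])

lemma laurent_t: "laurent t = fls_X"
  by (simp add: laurent_R expansion_eqI[OF expands_t])

lemma expansion_add: "y \<in> R \<Longrightarrow> z \<in> R \<Longrightarrow> expansion (y + z) = expansion y + expansion z"
  by (intro expansion_eqI expands_add expands_expansion)

lemma expansion_mult: "y \<in> R \<Longrightarrow> z \<in> R \<Longrightarrow> expansion (y * z) = expansion y * expansion z"
  by (intro expansion_eqI expands_mult expands_expansion)

lemma laurent_mult: "laurent (g * h) = laurent g * laurent h"
proof -
  obtain a b where g: "a \<in> R" "b \<in> R" "b \<noteq> 0" "g = a / b" using fractions[of g] by blast
  obtain c d where h: "c \<in> R" "d \<in> R" "d \<noteq> 0" "h = c / d" using fractions[of h] by blast
  have "g * h = (a * c) / (b * d)" by (simp add: g(4) h(4))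
  hence "laurent (g * h) = fps_to_fls (expansion a * expansion c) / fps_to_fls (expansion b * expansion d)"
    using g(1-3) h(1-3) by (simp add: laurent_fraction R_mult expansion_mult)
  thus ?thesis
    by (simp only: laurent_fraction g h fls_times_fps_to_fls times_divide_times_eq not_False_eq_True)
qed

lemma laurent_add: "laurent (g + h) = laurent g + laurent h"
proof -
  obtain a b where g: "a \<in> R" "b \<in> R" "b \<noteq> 0" "g = a / b" using fractions[of g] by blast
  obtain c d where h: "c \<in> R" "d \<in> R" "d \<noteq> 0" "h = c / d" using fractions[of h] by blast
  define A B C D where "A = fps_to_fls (expansion a)" "B = fps_to_fls (expansion b)"
    "C = fps_to_fls (expansion c)" "D = fps_to_fls (expansion d)"
  note ABCD = this
  have "B \<noteq> 0" "D \<noteq> 0" using g(1-3) h(1-3) by (simp_all add: ABCD expansion_eq_0_iff)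
  have "g + h = (a * d + c * b) / (b * d)"
    unfolding g(4) h(4) by (rule add_frac_eq) fact+
  moreover have "laurent ((a * d + c * b) / (b * d)) =
      fps_to_fls (expansion (a * d + c * b)) / fps_to_fls (expansion (b * d))"
    by (rule laurent_fraction) (use g(1-3) h(1-3) in \<open>simp_all add: R_add R_mult\<close>)
  moreover have "fps_to_fls (expansion (a * d + c * b)) = A * D + C * B"
    using g(1-3) h(1-3) by (simp add: expansion_add expansion_mult R_mult fls_times_fps_to_fls ABCD)
  moreover have "fps_to_fls (expansion (b * d)) = B * D"
    using g(1-3) h(1-3) by (simp add: expansion_mult fls_times_fps_to_fls ABCD)
  moreover have "A / B + C / D = (A * D + C * B) / (B * D)"
    by (rule add_frac_eq) fact+
  moreover have "laurent g = A / B" "laurent h = C / D"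
    unfolding g(4) h(4) ABCD by (intro laurent_fraction g h)+
  ultimately show ?thesis by simp
qed

lemma laurent_in_R_iff: "g \<in> R \<longleftrightarrow> 0 \<le> fls_subdegree (laurent g)"
proof
  assume "g \<in> R"
  thus "0 \<le> fls_subdegree (laurent g)" by (simp add: laurent_R fls_subdegree_fls_to_fps)
next
  assume *: "0 \<le> fls_subdegree (laurent g)"
  show "g \<in> R"
  proof (cases "g = 0")
    case False
    obtain a b where g: "a \<in> R" "b \<in> R" "b \<noteq> 0" "g = a / b" using fractions[of g] by blast
    with False have "a \<noteq> 0" by auto
    obtain u where u: "a = t ^ subdegree (expansion a) * u" "u \<in> R"
      using unit_decomposition[OF expands_expansion[OF g(1)] \<open>a \<noteq> 0\<close>] by blast
    obtain w where w: "b = t ^ subdegree (expansion b) * w" "inverse w \<in> R" "w \<noteq> 0"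
      using unit_decomposition[OF expands_expansion[OF g(2)] g(3)] by blast
    have le: "subdegree (expansion b) \<le> subdegree (expansion a)"
      using * g \<open>a \<noteq> 0\<close> by (simp add: laurent_fraction fls_divide_subdegree expansion_eq_0_iff fls_subdegree_fls_to_fps)
    have "g = t ^ subdegree (expansion a) * u / (t ^ subdegree (expansion b) * w)"
      using g(4) u(1) w(1) by simp
    also have "\<dots> = t ^ (subdegree (expansion a) - subdegree (expansion b)) * u * inverse w"
      using le t_nonzero w(3) by (simp add: power_diff field_simps)
    also have "\<dots> \<in> R" using u w by (intro R_mult R_power t_in_R)
    finally show ?thesis .
  qed simp
qed

end

section \<open>Laurent expansions, valuations and derivations\<close>

lemma fls_subdegree_diff_ge:
  assumes "0 \<le> m" "- m \<le> fls_subdegree F" "- m \<le> fls_subdegree G"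
  shows "- m \<le> fls_subdegree (F - G)"
  using assms fls_subdegree_minus[of F G] by (cases "F - G = 0") auto

lemma fls_subdegree_deriv_ge:
  fixes F :: "complex fls"
  assumes "fls_deriv F \<noteq> 0"
  shows "fls_subdegree F - 1 \<le> fls_subdegree (fls_deriv F)"
  using fls_subdegree_deriv[of F] fls_deriv_subdegree0[of F] by (cases "fls_subdegree F = 0") auto

lemma fls_subdegree_mult_deriv_divide:
  fixes F G :: "complex fls"
  assumes "fls_deriv F \<noteq> 0" "fls_deriv G \<noteq> 0"
  shows "fls_subdegree (G * fls_deriv F / fls_deriv G) =
    fls_subdegree G + fls_subdegree (fls_deriv F) - fls_subdegree (fls_deriv G)"
proof -
  have "G \<noteq> 0" using assms by auto
  thus ?thesis using assms by (simp add: fls_divide_subdegree)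
qed

text \<open>The effect on orders of \<open>\<theta> = x d/dx\<close>, in a Laurent field with \<open>F\<close> and \<open>G\<close> the expansions of the
  argument and of \<open>x\<close>: it creates no poles where \<open>x\<close> has a zero or a pole, nor on regular
  functions where \<open>x\<close> is unramified with a finite nonzero value; otherwise each
  application costs at most \<open>v(dx/dt) + 1\<close>.\<close>
lemma euler_operator_zero_or_pole:
  fixes F G :: "complex fls"
  assumes "fls_deriv G \<noteq> 0" "fls_subdegree G \<noteq> 0" "0 \<le> m" "- m \<le> fls_subdegree F"
  shows "- m \<le> fls_subdegree (G * fls_deriv F / fls_deriv G)"
proof (cases "fls_deriv F = 0")
  case False
  thus ?thesis
    using assms fls_subdegree_deriv[OF assms(2)] fls_subdegree_deriv_ge[OF False]
    by (simp add: fls_subdegree_mult_deriv_divide)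
qed (use assms in simp)

lemma euler_operator_finite_nonzero:
  fixes F G :: "complex fls"
  assumes "fls_deriv G \<noteq> 0" "fls_subdegree G = 0" "0 \<le> m" "- m \<le> fls_subdegree F"
  shows "- (m + (fls_subdegree (fls_deriv G) + 1)) \<le> fls_subdegree (G * fls_deriv F / fls_deriv G)"
proof (cases "fls_deriv F = 0")
  case True
  thus ?thesis using assms fls_deriv_subdegree0[of G] by simp
next
  case False
  thus ?thesis
    using assms fls_subdegree_deriv_ge[OF False]
    by (simp add: fls_subdegree_mult_deriv_divide)
qed

lemma euler_operator_regular:
  fixes F G :: "complex fls"
  assumes "fls_deriv G \<noteq> 0" "fls_subdegree G = 0" "fls_subdegree (fls_deriv G) = 0"
    "0 \<le> fls_subdegree F"
  shows "0 \<le> fls_subdegree (G * fls_deriv F / fls_deriv G)"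
proof (cases "fls_deriv F = 0")
  case False
  have "0 \<le> fls_subdegree (fls_deriv F)"
    using assms(4) fls_subdegree_deriv[of F] fls_deriv_subdegree0[of F]
    by (cases "fls_subdegree F = 0") auto
  thus ?thesis using assms False by (simp add: fls_subdegree_mult_deriv_divide)
qed simp

text \<open>An embedding \<open>E\<close> of \<open>K\<close> into the Laurent series field in \<open>t\<close>, with valuation ring \<open>R\<close>.\<close>
locale laurent_expansion = function_field +
  fixes R :: "'a set" and t :: 'a and E :: "'a \<Rightarrow> complex fls"
  assumes E_add [simp]: "E (g + h) = E g + E h"
    and E_mult [simp]: "E (g * h) = E g * E h"
    and E_const [simp]: "E (\<iota> c) = fls_const c"
    and E_t [simp]: "E t = fls_X"
    and R_iff: "g \<in> R \<longleftrightarrow> 0 \<le> fls_subdegree (E g)"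

sublocale regular_point \<subseteq> expansion: laurent_expansion \<iota> R t laurent
  by unfold_locales (simp_all add: laurent_add laurent_mult laurent_const laurent_t laurent_in_R_iff)

context laurent_expansion
begin

lemma E_0 [simp]: "E 0 = 0" and E_1 [simp]: "E 1 = 1"
  using E_const[of 0] E_const[of 1] by simp_all

lemma E_uminus [simp]: "E (- g) = - E g"
proof -
  have "E g + E (- g) = 0" by (simp flip: E_add)
  thus ?thesis by (simp add: eq_neg_iff_add_eq_0 add.commute)
qed

lemma E_diff [simp]: "E (g - h) = E g - E h"
  using E_add[of g "- h"] by (simp del: E_add)

lemma E_inverse_mult: "g \<noteq> 0 \<Longrightarrow> E g * E (inverse g) = 1"
  by (metis E_1 E_mult right_inverse)

lemma E_eq_0_iff [simp]: "E g = 0 \<longleftrightarrow> g = 0"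
  using E_inverse_mult by fastforce

lemma E_eq_iff: "E g = E h \<longleftrightarrow> g = h"
  using E_eq_0_iff[of "g - h"] by (simp del: E_eq_0_iff)

lemma E_inverse [simp]: "E (inverse g) = inverse (E g)"
  using E_inverse_mult[of g] inverse_unique[of "E g" "E (inverse g)"] by (cases "g = 0") auto

lemma E_divide [simp]: "E (g / h) = E g / E h"
  by (simp add: divide_inverse)

lemma E_power [simp]: "E (g ^ n) = E g ^ n"
  by (induction n) simp_all

lemma t_not_const: "t \<notin> range \<iota>"
proof
  assume "t \<in> range \<iota>"
  then obtain c where "t = \<iota> c" by blast
  hence "fls_X = fls_const c" using E_t by (simp del: E_t)
  from arg_cong[OF this, of fls_subdegree] show False by simp
qed

lemma t_nz [simp]: "t \<noteq> 0"
  using t_not_const by (metis \<iota>_0 rangeI)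

lemma subdegree_E_inverse: "fls_subdegree (inverse (E g)) = - fls_subdegree (E g)"
  using fls_divide_subdegree[of 1 "E g"] by (cases "g = 0") (auto simp: divide_inverse)

lemma subdegree_E_t_power: "fls_subdegree (E (t ^ n)) = int n"
  using fls_subdegree_mult_fls_X_power(1)[of "1 :: complex fls" n] by simp

lemma discrete_valuation_subdegree:
  "discrete_valuation (\<lambda>g. if g = 0 then \<infinity> else ereal (of_int (fls_subdegree (E g))))"
    (is "discrete_valuation ?v")
  unfolding discrete_valuation_def
proof (intro conjI allI)
  show "?v 0 = \<infinity>" by simp
  have surj: "\<exists>g. g \<noteq> 0 \<and> fls_subdegree (E g) = n" for n
  proof (cases "0 \<le> n")
    case True
    thus ?thesis using subdegree_E_t_power[of "nat n"] by (intro exI[of _ "t ^ nat n"]) auto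
  next
    case False
    thus ?thesis using subdegree_E_t_power[of "nat (- n)"] subdegree_E_inverse[of "t ^ nat (- n)"]
      by (intro exI[of _ "inverse (t ^ nat (- n))"]) (auto simp del: E_power power_inverse)
  qed
  show "?v ` (UNIV - {0}) = range (\<lambda>n::int. ereal (of_int n))"
  proof (intro equalityI subsetI)
    fix a assume "a \<in> range (\<lambda>n::int. ereal (of_int n))"
    then obtain n where n: "a = ereal (of_int n)" by blast
    obtain g where "g \<noteq> 0" "fls_subdegree (E g) = n" using surj by blast
    thus "a \<in> ?v ` (UNIV - {0})" using n by (intro image_eqI[of _ _ g]) auto
  qed auto
  show "?v (g * h) = ?v g + ?v h" for g h by simp
  show "min (?v g) (?v h) \<le> ?v (g + h)" for g h
    using fls_plus_subdegree[of "E g" "E h"] E_eq_0_iff[of "g + h"]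
    by (cases "g = 0"; cases "h = 0"; cases "g + h = 0") (auto simp: min_def split: if_splits)
qed

lemma discrete_valuation_unique:
  assumes v: "discrete_valuation v" "{g. 0 \<le> v g} = R"
  shows "v g = (if g = 0 then \<infinity> else ereal (of_int (fls_subdegree (E g))))"
proof -
  have "\<exists>w. \<forall>g. g \<noteq> 0 \<longrightarrow> v g = ereal (of_int (w g))"
  proof (intro choice allI)
    fix g :: 'a
    show "\<exists>n::int. g \<noteq> 0 \<longrightarrow> v g = ereal (of_int n)"
    proof (cases "g = 0")
      case False
      hence "v g \<in> v ` (UNIV - {0})" by blast
      thus ?thesis using v(1) by (auto simp: discrete_valuation_def)
    qed simp
  qed
  then obtain w :: "'a \<Rightarrow> int" where w: "\<And>g. g \<noteq> 0 \<Longrightarrow> v g = ereal (of_int (w g))" by blast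
  have w_mult: "w (g * h) = w g + w h" if "g \<noteq> 0" "h \<noteq> 0" for g h
  proof -
    have "v (g * h) = v g + v h" using v(1) by (simp add: discrete_valuation_def)
    thus ?thesis using that by (simp add: w flip: of_int_add)
  qed
  have "w 1 = 0" using w_mult[of 1 1] by simp
  have w_power: "w (t ^ n) = int n * w t" for n
    by (induction n) (simp_all add: \<open>w 1 = 0\<close> w_mult algebra_simps)
  have unit: "w u = 0" if "u \<noteq> 0" "fls_subdegree (E u) = 0" for u
  proof -
    have "u \<in> R" "inverse u \<in> R" using that subdegree_E_inverse[of u] by (simp_all add: R_iff)
    hence "0 \<le> v u" "0 \<le> v (inverse u)" using v(2) by blast+
    hence "0 \<le> w u" "0 \<le> w (inverse u)" using that by (simp_all add: w)
    moreover have "w u + w (inverse u) = 0"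
      using w_mult[of u "inverse u"] that \<open>w 1 = 0\<close> by simp
    ultimately show ?thesis by linarith
  qed
  have *: "w g = fls_subdegree (E g) * w t" if "g \<noteq> 0" for g
  proof (cases "0 \<le> fls_subdegree (E g)")
    case True
    define n where "n = nat (fls_subdegree (E g))"
    have "w (g / t ^ n) = 0"
      using that True subdegree_E_t_power[of n]
      by (intro unit) (simp_all add: n_def fls_divide_subdegree)
    hence "w g = w (t ^ n)" using w_mult[of "g / t ^ n" "t ^ n"] that by simp
    thus ?thesis using True by (simp add: w_power n_def)
  next
    case False
    define n where "n = nat (- fls_subdegree (E g))"
    have "w (g * t ^ n) = 0"
      using that False subdegree_E_t_power[of n] by (intro unit) (simp_all add: n_def)
    hence "w g = - w (t ^ n)" using w_mult[of g "t ^ n"] that by simp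
    thus ?thesis using False by (simp add: w_power n_def)
  qed
  have "ereal (of_int 1) \<in> v ` (UNIV - {0})"
    using v(1) unfolding discrete_valuation_def by blast
  then obtain g1 where "g1 \<noteq> 0" "ereal (of_int 1) = v g1" by blast
  hence "w g1 = 1" using w[of g1] by simp
  hence "w t dvd 1" using *[of g1] \<open>g1 \<noteq> 0\<close> by (metis dvd_triv_right)
  moreover have "0 \<le> w t"
  proof -
    have "t \<in> R" by (simp add: R_iff)
    hence "0 \<le> v t" using v(2) by blast
    thus ?thesis by (simp add: w)
  qed
  ultimately have "w t = 1" by simp
  hence "w g = fls_subdegree (E g)" if "g \<noteq> 0" using *[OF that] by simp
  moreover have "v 0 = \<infinity>" using v(1) by (simp add: discrete_valuation_def)
  ultimately show ?thesis using w[of g] by (cases "g = 0") simp_all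
qed

lemma val_at_eq: "val_at R g = (if g = 0 then \<infinity> else ereal (of_int (fls_subdegree (E g))))"
proof -
  have "val_at R = (\<lambda>g. if g = 0 then \<infinity> else ereal (of_int (fls_subdegree (E g))))"
    unfolding val_at_def
  proof (rule the_equality)
    show "discrete_valuation (\<lambda>g. if g = 0 then \<infinity> else ereal (of_int (fls_subdegree (E g)))) \<and>
      {g. 0 \<le> (if g = 0 then \<infinity> else ereal (of_int (fls_subdegree (E g))))} = R"
      using discrete_valuation_subdegree by (auto simp: R_iff)
  qed (use discrete_valuation_unique in blast)
  thus ?thesis by simp
qed

text \<open>The derivative in \<open>\<complex>((t))\<close> maps \<open>K\<close> to itself, since differentiating an algebraic
  relation \<open>P(t, g) = 0\<close> expresses the derivative of \<open>g\<close> rationally in \<open>t\<close> and \<open>g\<close>.\<close>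
lemma derivative_in_K: "\<exists>h. E h = fls_deriv (E g)"
proof -
  obtain P where P: "eval2 \<iota> P t g = 0" "eval2 \<iota> (pderiv P) t g \<noteq> 0"
    using separable_dependence[OF t_not_const] by blast
  have "fls_deriv (E (eval2 \<iota> P t g)) =
    E (eval2 \<iota> (map_poly pderiv P) t g) * fls_deriv (E t) + E (eval2 \<iota> (pderiv P) t g) * fls_deriv (E g)"
    by (rule derivation_eval2) (simp_all add: algebra_simps)
  hence "E (eval2 \<iota> (pderiv P) t g) * fls_deriv (E g) = - E (eval2 \<iota> (map_poly pderiv P) t g)"
    using P by (simp add: add_eq_0_iff)
  hence "fls_deriv (E g) = E (- eval2 \<iota> (map_poly pderiv P) t g / eval2 \<iota> (pderiv P) t g)"
    using P nonzero_eq_divide_eq[of "E (eval2 \<iota> (pderiv P) t g)" "fls_deriv (E g)"]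
    by (simp add: mult.commute del: divide_minus_left)
  thus ?thesis by metis
qed

end

context function_field
begin

lemma complex_derivation_const:
  assumes "complex_derivation \<iota> D"
  shows "D (\<iota> c) = 0"
proof -
  have "D 1 = D 1 + D 1" using assms unfolding complex_derivation_def by (metis mult_1 mult_1_right)
  hence "D 1 = 0" by (metis add_cancel_right_right)
  moreover have "D (\<iota> c * 1) = \<iota> c * D 1" using assms unfolding complex_derivation_def by blast
  ultimately show ?thesis by simp
qed

lemma complex_derivation_eval2:
  assumes "complex_derivation \<iota> D"
  shows "D (eval2 \<iota> P y z) = eval2 \<iota> (map_poly pderiv P) y z * D y + eval2 \<iota> (pderiv P) y z * D z"
  using derivation_eval2[of "\<lambda>g. g" D P y z] complex_derivation_const[OF assms] assms
  by (simp add: complex_derivation_def)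

lemma complex_derivation_unique:
  assumes "y \<notin> range \<iota>" "complex_derivation \<iota> D" "complex_derivation \<iota> D'" "D y = D' y"
  shows "D = D'"
proof
  fix z
  obtain P where P: "eval2 \<iota> P y z = 0" "eval2 \<iota> (pderiv P) y z \<noteq> 0"
    using separable_dependence[OF assms(1)] by blast
  have "D 0 = D' 0"
    using complex_derivation_const[OF assms(2), of 0] complex_derivation_const[OF assms(3), of 0] by simp
  thus "D z = D' z"
    using complex_derivation_eval2[OF assms(2), of P y z] complex_derivation_eval2[OF assms(3), of P y z]
      P assms(4) by simp
qed

end

context laurent_expansion
begin

lemma nonconst_deriv: "x \<notin> range \<iota> \<Longrightarrow> fls_deriv (E x) \<noteq> 0"
  using E_eq_iff[of x "\<iota> (E x $$ 0)"] by (auto simp: fls_deriv_eq_0_iff)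

text \<open>\<open>d/dx\<close> exists and is the quotient of derivatives in the Laurent field; it is unique because
  \<open>K\<close> is separable algebraic over \<open>\<complex>(x)\<close>.\<close>
lemma ddx_derivation:
  assumes "x \<notin> range \<iota>"
  shows "complex_derivation \<iota> (ddx \<iota> x)" and "ddx \<iota> x x = 1"
    and E_ddx: "E (ddx \<iota> x g) = fls_deriv (E g) / fls_deriv (E x)"
proof -
  note nz = nonconst_deriv[OF assms]
  obtain D where D: "\<And>g. E (D g) = fls_deriv (E g)"
    using derivative_in_K by metis
  define D' where "D' g = D g / D x" for g
  have D': "E (D' g) = fls_deriv (E g) / fls_deriv (E x)" for g
    by (simp add: D'_def D)
  have der: "complex_derivation \<iota> D'"
    unfolding complex_derivation_def
    by (simp add: E_eq_iff[symmetric] D' add_divide_distrib algebra_simps)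
  have one: "D' x = 1"
    using nz by (simp add: E_eq_iff[symmetric] D')
  have "ddx \<iota> x = D'"
    unfolding ddx_def
    by (rule the_equality) (use der one complex_derivation_unique[OF assms] in auto)
  thus "complex_derivation \<iota> (ddx \<iota> x)" "ddx \<iota> x x = 1"
    "E (ddx \<iota> x g) = fls_deriv (E g) / fls_deriv (E x)"
    using der one D' by simp_all
qed

lemma E_ddx_t: "E (ddx \<iota> t g) = fls_deriv (E g)"
  by (simp add: E_ddx[OF t_not_const])

lemma val_at_ddx_t:
  assumes "x \<notin> range \<iota>"
  shows "val_at R (ddx \<iota> t x) = ereal (of_int (fls_subdegree (fls_deriv (E x))))"
proof -
  have "ddx \<iota> t x \<noteq> 0"
    using nonconst_deriv[OF assms] E_eq_0_iff[of "ddx \<iota> t x"] by (simp add: E_ddx_t del: E_eq_0_iff)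
  thus ?thesis by (simp add: val_at_eq E_ddx_t)
qed

text \<open>Two nonzero elements of the same order have proportional leading terms.\<close>
lemma cancel_leading_term:
  assumes "g \<noteq> 0" "h \<noteq> 0" "fls_subdegree (E g) = fls_subdegree (E h)"
  obtains c where "g - \<iota> c * h = 0 \<or> fls_subdegree (E g) < fls_subdegree (E (g - \<iota> c * h))"
proof -
  define n where "n = fls_subdegree (E g)"
  define c where "c = E g $$ n / E h $$ n"
  have nz: "E h $$ n \<noteq> 0" using assms by (metis E_eq_0_iff n_def nth_fls_subdegree_zero_iff)
  have "n < fls_subdegree (E (g - \<iota> c * h))" if "g - \<iota> c * h \<noteq> 0"
  proof (rule fls_subdegree_greaterI)
    show "E (g - \<iota> c * h) \<noteq> 0" using that E_eq_0_iff by blast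
    fix k assume "k \<le> n"
    show "E (g - \<iota> c * h) $$ k = 0"
    proof (cases "k = n")
      case False
      with \<open>k \<le> n\<close> have "E g $$ k = 0" "E h $$ k = 0" using assms(3) by (simp_all add: n_def)
      thus ?thesis by simp
    qed (use nz in \<open>simp add: c_def\<close>)
  qed
  thus thesis using that[of c] by (auto simp: n_def)
qed

end

lemma (in regular_point) regular_point_parameter:
  assumes "val_at R s = 1"
  shows "regular_point \<iota> R s"
proof
  show "subalgebra \<iota> R" by (rule subalgebra)
  show "\<exists>a\<in>R. \<exists>b\<in>R. b \<noteq> 0 \<and> g = a / b" for g by (rule fractions)
  have s: "s \<noteq> 0" "fls_subdegree (laurent s) = 1"
    using assms expansion.val_at_eq[of s] by (auto split: if_splits simp: one_ereal_def)
  thus "s \<noteq> 0" by simp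
  have "inverse t * s \<in> R" "t / s \<in> R"
    using s by (auto simp: laurent_in_R_iff fls_divide_subdegree expansion.subdegree_E_inverse)
  show "nonunits R = {s * g | g. g \<in> R}"
    unfolding nonunits_eq
  proof (intro equalityI subsetI)
    fix y assume "y \<in> {t * g | g. g \<in> R}"
    then obtain g where "g \<in> R" "y = s * (t / s * g)" using s by auto
    thus "y \<in> {s * g | g. g \<in> R}" using \<open>t / s \<in> R\<close> R_mult by blast
  next
    fix y assume "y \<in> {s * g | g. g \<in> R}"
    then obtain g where "g \<in> R" "y = t * (inverse t * s * g)" using t_nonzero by auto
    thus "y \<in> {t * g | g. g \<in> R}" using \<open>inverse t * s \<in> R\<close> R_mult by blast
  qed
qed

section \<open>Points of affine charts\<close>

lemma (in laurent_expansion) nonunit_iff: "g \<in> nonunits R \<longleftrightarrow> g = 0 \<or> 0 < fls_subdegree (E g)"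
  unfolding nonunits_def by (auto simp: R_iff subdegree_E_inverse)

lemma (in regular_point) nonunits_add: "a \<in> nonunits R \<Longrightarrow> b \<in> nonunits R \<Longrightarrow> a + b \<in> nonunits R"
  unfolding nonunits_eq using R_add by (auto simp flip: distrib_left)

lemma (in regular_point) nonunits_mult: "a \<in> R \<Longrightarrow> b \<in> nonunits R \<Longrightarrow> a * b \<in> nonunits R"
  unfolding nonunits_eq using R_mult by (auto simp: mult.left_commute)

lemma generated_algebra_least: "subalgebra \<iota> B \<Longrightarrow> S \<subseteq> B \<Longrightarrow> generated_algebra \<iota> S \<subseteq> B"
  unfolding generated_algebra_def by blast

lemma subalgebra_generated: "subalgebra \<iota> (generated_algebra \<iota> S)"
  by (auto simp: generated_algebra_def subalgebra_def)

lemma generators_in_algebra: "S \<subseteq> generated_algebra \<iota> S"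
  unfolding generated_algebra_def by blast

context function_field
begin

lemma subalgebra_0: "subalgebra \<iota> A \<Longrightarrow> 0 \<in> A"
  and subalgebra_1: "subalgebra \<iota> A \<Longrightarrow> 1 \<in> A"
  unfolding subalgebra_def by (metis \<iota>_0 range_subsetD, metis \<iota>_1 range_subsetD)

lemma subalgebra_uminus:
  assumes "subalgebra \<iota> A" "a \<in> A"
  shows "- a \<in> A"
proof -
  have "\<iota> (- 1) * a \<in> A" using assms unfolding subalgebra_def by blast
  thus ?thesis by simp
qed

lemma maximal_idealD:
  assumes "maximal_ideal A M"
  shows "M \<subseteq> A" "0 \<in> M" "u \<in> M \<Longrightarrow> v \<in> M \<Longrightarrow> u + v \<in> M" "a \<in> A \<Longrightarrow> v \<in> M \<Longrightarrow> a * v \<in> M"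
    "M \<noteq> A" "is_ideal A J \<Longrightarrow> M \<subseteq> J \<Longrightarrow> J = M \<or> J = A"
proof -
  have "is_ideal A M" using assms by (simp add: maximal_ideal_def)
  thus "M \<subseteq> A" "0 \<in> M" "u \<in> M \<Longrightarrow> v \<in> M \<Longrightarrow> u + v \<in> M" "a \<in> A \<Longrightarrow> v \<in> M \<Longrightarrow> a * v \<in> M"
    by (auto simp: is_ideal_def)
  show "M \<noteq> A" "is_ideal A J \<Longrightarrow> M \<subseteq> J \<Longrightarrow> J = M \<or> J = A"
    using assms by (auto simp: maximal_ideal_def)
qed

lemma maximal_ideal_proper:
  assumes "subalgebra \<iota> A" "maximal_ideal A M"
  shows "1 \<notin> M"
proof
  assume "1 \<in> M"
  hence "A \<subseteq> M" using maximal_idealD(4)[OF assms(2), of _ 1] by auto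
  thus False using maximal_idealD(1,5)[OF assms(2)] by blast
qed

lemma maximal_ideal_prime:
  assumes A: "subalgebra \<iota> A" and M: "maximal_ideal A M"
    and ab: "a \<in> A" "b \<in> A" "a * b \<in> M" "a \<notin> M"
  shows "b \<in> M"
proof -
  define J where "J = {m + a * r | m r. m \<in> M \<and> r \<in> A}"
  note id = maximal_idealD(1-4)[OF M] and max = maximal_idealD(6)[OF M]
  have add: "\<And>u v. u \<in> A \<Longrightarrow> v \<in> A \<Longrightarrow> u + v \<in> A" and mult: "\<And>u v. u \<in> A \<Longrightarrow> v \<in> A \<Longrightarrow> u * v \<in> A"
    using A by (auto simp: subalgebra_def)
  have JI: "m + a * r \<in> J" if "m \<in> M" "r \<in> A" for m r
    unfolding J_def using that by blast
  have "is_ideal A J"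
    unfolding is_ideal_def
  proof (intro conjI ballI)
    show "J \<subseteq> A" using id add mult ab by (auto simp: J_def)
    show "0 \<in> J" using JI[of 0 0] id subalgebra_0[OF A] by simp
    fix u v assume "v \<in> J"
    then obtain m r where v: "m \<in> M" "r \<in> A" "v = m + a * r" by (auto simp: J_def)
    show "u + v \<in> J" if uJ: "u \<in> J"
    proof -
      obtain m' r' where u: "m' \<in> M" "r' \<in> A" "u = m' + a * r'" using uJ by (auto simp: J_def)
      have "u + v = (m' + m) + a * (r' + r)" by (simp add: u v algebra_simps)
      thus ?thesis using JI[OF id(3)[OF u(1) v(1)] add[OF u(2) v(2)]] by simp
    qed
    show "u * v \<in> J" if uA: "u \<in> A"
    proof -
      have "u * v = u * m + a * (u * r)" by (simp add: v algebra_simps)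
      thus ?thesis using JI[OF id(4)[OF uA v(1)] mult[OF uA v(2)]] by simp
    qed
  qed
  moreover have "M \<subseteq> J" using JI[of _ 0] subalgebra_0[OF A] by auto
  moreover have "a \<in> J" using JI[of 0 1] id subalgebra_1[OF A] by simp
  ultimately have "J = A" using max ab by blast
  then obtain m r where "m \<in> M" "r \<in> A" "1 = m + a * r"
    using subalgebra_1[OF A] unfolding J_def by blast
  hence "b = b * m + r * (a * b)" by (metis distrib_left mult.commute mult.left_commute mult_1_right)
  thus ?thesis using id \<open>m \<in> M\<close> \<open>r \<in> A\<close> ab by metis
qed

lemma localization_facts:
  assumes A: "subalgebra \<iota> A" and M: "maximal_ideal A M"
  shows subalgebra_localization: "subalgebra \<iota> (localization A M)"
    and localization_superset: "A \<subseteq> localization A M"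
    and localization_nonunits: "a \<in> A \<Longrightarrow> a \<in> nonunits (localization A M) \<longleftrightarrow> a \<in> M"
proof -
  note id = maximal_idealD(1,2,4)[OF M]
  have add: "\<And>u v. u \<in> A \<Longrightarrow> v \<in> A \<Longrightarrow> u + v \<in> A" and mult: "\<And>u v. u \<in> A \<Longrightarrow> v \<in> A \<Longrightarrow> u * v \<in> A"
    and const: "\<And>c. \<iota> c \<in> A"
    using A by (auto simp: subalgebra_def)
  have LI: "u / v \<in> localization A M" if "u \<in> A" "v \<in> A - M" for u v
    using that unfolding localization_def by blast
  have one: "1 \<in> A - M" using maximal_ideal_proper[OF assms] subalgebra_1[OF A] by blast
  have prod: "u * v \<in> A - M" if "u \<in> A - M" "v \<in> A - M" for u v
    using that maximal_ideal_prime[OF assms] mult by blast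
  show sup: "A \<subseteq> localization A M"
    using LI[OF _ one] by auto
  show "subalgebra \<iota> (localization A M)"
    unfolding subalgebra_def
  proof (intro conjI ballI)
    show "range \<iota> \<subseteq> localization A M" using sup const by blast
    fix u v assume "u \<in> localization A M" "v \<in> localization A M"
    then obtain a b c d where uv: "u = a / b" "v = c / d" "a \<in> A" "b \<in> A - M" "c \<in> A" "d \<in> A - M"
      unfolding localization_def by blast
    have "b \<noteq> 0" "d \<noteq> 0" using uv id by auto
    hence "u + v = (a * d + c * b) / (b * d)" by (simp add: uv add_frac_eq)
    moreover have "a * d + c * b \<in> A" using uv add mult by blast
    ultimately show "u + v \<in> localization A M" using LI prod uv by simp
    have "u * v = (a * c) / (b * d)" by (simp add: uv)
    thus "u * v \<in> localization A M" using LI prod mult uv by simp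
  qed
  show "a \<in> nonunits (localization A M) \<longleftrightarrow> a \<in> M" if aA: "a \<in> A"
  proof (cases "a = 0")
    case True
    thus ?thesis using id sup aA by (auto simp: nonunits_def)
  next
    case False
    have "inverse a \<in> localization A M \<longleftrightarrow> a \<notin> M"
    proof
      assume "inverse a \<in> localization A M"
      then obtain c b where cb: "c \<in> A" "b \<in> A - M" "inverse a = c / b"
        unfolding localization_def by blast
      have "b \<noteq> 0" using cb id by auto
      hence "b = c * a" using cb False by (simp add: field_simps)
      thus "a \<notin> M" using cb id by auto
    next
      assume "a \<notin> M"
      thus "inverse a \<in> localization A M" using LI[of 1 a] aA one by (simp add: inverse_eq_divide)
    qed
    thus ?thesis using False sup aA by (auto simp: nonunits_def)
  qed
qed

lemma affine_coordinate_ring_subalgebra: "affine_coordinate_ring \<iota> A \<Longrightarrow> subalgebra \<iota> A"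
  unfolding affine_coordinate_ring_def using subalgebra_generated by blast

lemma affine_point_regular:
  assumes A: "affine_coordinate_ring \<iota> A" and q: "q \<in> affine_points A"
    and t: "t \<noteq> 0" "nonunits q = {t * g | g. g \<in> q}"
  shows "regular_point \<iota> q t"
proof -
  obtain M where M: "maximal_ideal A M" "q = localization A M"
    using q unfolding affine_points_def by blast
  note sub = affine_coordinate_ring_subalgebra[OF A]
  note loc = localization_facts[OF sub M(1), folded M(2)]
  show ?thesis
  proof
    show "subalgebra \<iota> q" by (rule loc)
    show "\<exists>a\<in>q. \<exists>b\<in>q. b \<noteq> 0 \<and> g = a / b" for g
      using A loc(2) unfolding affine_coordinate_ring_def by blast
  qed (use t in auto)
qed

text \<open>A point of a chart is determined by the residues of the finitely many generators.\<close>
lemma affine_point_eqI: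
  assumes A: "A = generated_algebra \<iota> S"
    and q: "q \<in> affine_points A" "regular_point \<iota> q t"
    and r: "r \<in> affine_points A" "regular_point \<iota> r u"
    and S: "\<And>s. s \<in> S \<Longrightarrow> s - \<iota> (c s) \<in> nonunits q \<and> s - \<iota> (c s) \<in> nonunits r"
  shows "q = r"
proof -
  interpret q: regular_point \<iota> q t by fact
  interpret r: regular_point \<iota> r u by fact
  have sub: "subalgebra \<iota> A" unfolding A by (rule subalgebra_generated)
  define B where "B = {a. \<exists>c. a - \<iota> c \<in> nonunits q \<and> a - \<iota> c \<in> nonunits r}"
  have *: "R_in" if "a - \<iota> c \<in> nonunits R" "regular_point \<iota> R w" "R_in = (a \<in> R)" for a c R w R_in
  proof -
    interpret regular_point \<iota> R w by fact
    have "a - \<iota> c \<in> R" using that by (simp add: nonunits_def)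
    from R_add[OF this R_const[of c]] show ?thesis using that by simp
  qed
  have "subalgebra \<iota> B"
    unfolding subalgebra_def
  proof (intro conjI ballI subsetI)
    fix a assume "a \<in> range \<iota>"
    then obtain c where "a = \<iota> c" by blast
    thus "a \<in> B" unfolding B_def by (auto simp: nonunits_def intro!: exI[of _ c])
  next
    fix a b assume "a \<in> B" "b \<in> B"
    then obtain c d where cd: "a - \<iota> c \<in> nonunits q" "a - \<iota> c \<in> nonunits r"
      "b - \<iota> d \<in> nonunits q" "b - \<iota> d \<in> nonunits r" unfolding B_def by blast
    have "a + b - \<iota> (c + d) = (a - \<iota> c) + (b - \<iota> d)" by simp
    thus "a + b \<in> B" unfolding B_def
      using cd q.nonunits_add r.nonunits_add by (metis (mono_tags, lifting) mem_Collect_eq)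
    have "a * b - \<iota> (c * d) = a * (b - \<iota> d) + \<iota> d * (a - \<iota> c)" by (simp add: algebra_simps)
    moreover have "a \<in> q" "a \<in> r" using *[OF cd(1) q(2)] *[OF cd(2) r(2)] by auto
    ultimately show "a * b \<in> B" unfolding B_def
      using cd by (intro CollectI exI[of _ "c * d"])
        (auto intro!: q.nonunits_add r.nonunits_add q.nonunits_mult r.nonunits_mult)
  qed
  moreover have "S \<subseteq> B" using S unfolding B_def by blast
  ultimately have "A \<subseteq> B" unfolding A by (rule generated_algebra_least)
  have same: "a \<in> nonunits q \<longleftrightarrow> a \<in> nonunits r" if aA: "a \<in> A" for a
  proof -
    obtain c where c: "a - \<iota> c \<in> nonunits q" "a - \<iota> c \<in> nonunits r"
      using \<open>A \<subseteq> B\<close> aA unfolding B_def by blast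
    have "a \<in> nonunits R \<longleftrightarrow> c = 0" if "a - \<iota> c \<in> nonunits R" "regular_point \<iota> R w" for R w
    proof -
      interpret regular_point \<iota> R w by fact
      have "\<iota> c \<in> nonunits R" if "a \<in> nonunits R"
        using nonunits_add[OF that nonunits_mult[OF R_const[of "- 1"] \<open>a - \<iota> c \<in> nonunits R\<close>]]
        by simp
      thus ?thesis using const_unit that by auto
    qed
    from this[OF c(1) q(2)] this[OF c(2) r(2)] show ?thesis by simp
  qed
  obtain M where M: "maximal_ideal A M" "q = localization A M"
    using q unfolding affine_points_def by blast
  obtain N where N: "maximal_ideal A N" "r = localization A N"
    using r unfolding affine_points_def by blast
  have "M = A \<inter> nonunits q" "N = A \<inter> nonunits r"
    using localization_nonunits[OF sub M(1)] localization_nonunits[OF sub N(1)] M(2) N(2)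
      maximal_idealD(1)[OF M(1)] maximal_idealD(1)[OF N(1)] by blast+
  hence "M = N" using same by blast
  thus ?thesis using M N by simp
qed

text \<open>At a zero of \<open>g\<close> the residue of each generator is a root of the reduction of its algebraic
  dependence on \<open>g\<close>.\<close>
lemma finite_zeros_affine:
  assumes A: "affine_coordinate_ring \<iota> A" and "g \<noteq> 0"
    and reg: "\<And>q. q \<in> affine_points A \<Longrightarrow> \<exists>t. regular_point \<iota> q t"
  shows "finite {q \<in> affine_points A. g \<in> nonunits q}" (is "finite ?Z")
proof -
  obtain S where S: "finite S" "A = generated_algebra \<iota> S"
    using A unfolding affine_coordinate_ring_def by blast
  have "\<exists>P. eval2 \<iota> P g s = 0 \<and> map_poly (\<lambda>p. coeff p 0) P \<noteq> 0" for s
    using reduced_dependence[OF \<open>g \<noteq> 0\<close>] by metis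
  then obtain P where P: "\<And>s. eval2 \<iota> (P s) g s = 0" "\<And>s. map_poly (\<lambda>p. coeff p 0) (P s) \<noteq> 0"
    by metis
  define P0 where "P0 s = map_poly (\<lambda>p. coeff p 0) (P s)" for s
  have ex: "\<exists>c. s - \<iota> c \<in> nonunits q \<and> poly (P0 s) c = 0" if qZ: "q \<in> ?Z" and sS: "s \<in> S" for q s
  proof -
    obtain t where "regular_point \<iota> q t" using reg qZ by blast
    then interpret regular_point \<iota> q t .
    obtain M where M: "maximal_ideal A M" "q = localization A M"
      using qZ unfolding affine_points_def by blast
    have "s \<in> q"
      using localization_superset[OF affine_coordinate_ring_subalgebra[OF A] M(1)] M(2)
        generators_in_algebra[of S \<iota>] sS S(2) by blast
    have "g \<in> q" using qZ by (simp add: nonunits_def)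
    obtain r where r: "r \<in> q" "0 = peval (P0 s) s + g * r"
      using eval2_reduce[OF subalgebra \<open>g \<in> q\<close> \<open>s \<in> q\<close>, of "P s"] P(1) by (auto simp: P0_def)
    hence "peval (P0 s) s = (- r) * g" by (simp add: eq_neg_iff_add_eq_0 mult.commute)
    also have "\<dots> \<in> nonunits q" using qZ r(1) by (intro nonunits_mult R_uminus) auto
    finally show ?thesis
      using peval_in_prime_imp_root[of "P0 s" s "nonunits q" q] P(2) R_peval[OF \<open>s \<in> q\<close>]
        const_unit nonunits_prime by (auto simp: P0_def)
  qed
  define c where "c q s = (SOME c. s - \<iota> c \<in> nonunits q \<and> poly (P0 s) c = 0)" for q s
  have c: "s - \<iota> (c q s) \<in> nonunits q \<and> poly (P0 s) (c q s) = 0" if "q \<in> ?Z" "s \<in> S" for q s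
    unfolding c_def using someI_ex[OF ex[OF that]] .
  have "inj_on (\<lambda>q. restrict (c q) S) ?Z"
  proof (rule inj_onI)
    fix q r assume q: "q \<in> ?Z" and r: "r \<in> ?Z" and eq: "restrict (c q) S = restrict (c r) S"
    obtain t u where tu: "regular_point \<iota> q t" "regular_point \<iota> r u" using reg q r by blast
    have "c q s = c r s" if "s \<in> S" for s using fun_cong[OF eq, of s] that by simp
    hence "s - \<iota> (c q s) \<in> nonunits q \<and> s - \<iota> (c q s) \<in> nonunits r" if "s \<in> S" for s
      using c[OF q that] c[OF r that] that by simp
    thus "q = r" using affine_point_eqI[OF S(2) _ tu(1) _ tu(2)] q r by blast
  qed
  moreover have "(\<lambda>q. restrict (c q) S) ` ?Z \<subseteq> (\<Pi>\<^sub>E s\<in>S. {z. poly (P0 s) z = 0})"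
    using c by auto
  moreover have "finite (\<Pi>\<^sub>E s\<in>S. {z. poly (P0 s) z = 0})"
    using S(1) P(2) by (intro finite_PiE poly_roots_finite) (auto simp: P0_def)
  ultimately show ?thesis using finite_imageD finite_subset by blast
qed

text \<open>Where \<open>x\<close> is regular, \<open>d/dx\<close> preserves the local ring except at the finitely many points where
  \<open>\<partial>P/\<partial>Z (x, s)\<close> vanishes for the separable relation \<open>P(x, s) = 0\<close> of some generator \<open>s\<close>.\<close>
lemma finite_irregular_derivation:
  assumes A: "affine_coordinate_ring \<iota> A" and x: "x \<notin> range \<iota>"
    and reg: "\<And>q. q \<in> affine_points A \<Longrightarrow> \<exists>t. regular_point \<iota> q t"
    and D: "complex_derivation \<iota> D" "D x = 1"
  shows "finite {q \<in> affine_points A. x \<in> q \<and> \<not> D ` q \<subseteq> q}"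
proof -
  obtain S where S: "finite S" "A = generated_algebra \<iota> S"
    using A unfolding affine_coordinate_ring_def by blast
  have "\<exists>P. eval2 \<iota> P x s = 0 \<and> eval2 \<iota> (pderiv P) x s \<noteq> 0" for s
    using separable_dependence[OF x] by metis
  then obtain P where P: "\<And>s. eval2 \<iota> (P s) x s = 0" "\<And>s. eval2 \<iota> (pderiv (P s)) x s \<noteq> 0"
    by metis
  define w where "w s = eval2 \<iota> (pderiv (P s)) x s" for s
  have "{q \<in> affine_points A. x \<in> q \<and> \<not> D ` q \<subseteq> q} \<subseteq>
      (\<Union>s\<in>S. {q \<in> affine_points A. w s \<in> nonunits q})"
  proof (rule subsetI, rule ccontr)
    fix q assume q: "q \<in> {q \<in> affine_points A. x \<in> q \<and> \<not> D ` q \<subseteq> q}"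
      and nin: "q \<notin> (\<Union>s\<in>S. {q \<in> affine_points A. w s \<in> nonunits q})"
    obtain t where "regular_point \<iota> q t" using reg q by blast
    then interpret regular_point \<iota> q t .
    obtain M where M: "maximal_ideal A M" "q = localization A M"
      using q unfolding affine_points_def by blast
    note loc = localization_facts[OF affine_coordinate_ring_subalgebra[OF A] M(1), folded M(2)]
    have ev: "eval2 \<iota> Q x s \<in> q" if "s \<in> q" for Q s
      using that q by (induction Q) (auto intro!: R_add R_mult R_peval)
    have D0: "D 0 = 0" using complex_derivation_const[OF D(1), of 0] by simp
    have Dadd: "D (a + b) = D a + D b" and Dmult: "D (a * b) = D a * b + a * D b" for a b
      using D(1) by (simp_all add: complex_derivation_def)
    define B where "B = {a \<in> q. D a \<in> q}"
    have "subalgebra \<iota> B"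
      unfolding subalgebra_def B_def
      by (auto simp: complex_derivation_const[OF D(1)] Dadd Dmult intro: R_add R_mult)
    moreover have "S \<subseteq> B"
    proof
      fix s assume "s \<in> S"
      hence "s \<in> q" using generators_in_algebra[of S \<iota>] S(2) loc(2) by blast
      have "w s \<notin> nonunits q" using nin q \<open>s \<in> S\<close> by blast
      moreover have "w s \<in> q" unfolding w_def by (rule ev) fact
      ultimately have inv: "inverse (w s) \<in> q" by (simp add: nonunits_def)
      have "eval2 \<iota> (map_poly pderiv (P s)) x s + w s * D s = 0"
        using complex_derivation_eval2[OF D(1), of "P s" x s] P(1)[of s] D(2) D0 by (simp add: w_def)
      hence "w s * D s = - eval2 \<iota> (map_poly pderiv (P s)) x s"
        by (simp add: add_eq_0_iff)
      hence "D s = inverse (w s) * (- eval2 \<iota> (map_poly pderiv (P s)) x s)"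
        using P(2)[of s] unfolding w_def by (simp add: field_simps)
      also have "\<dots> \<in> q" using inv \<open>s \<in> q\<close> by (intro R_mult R_uminus ev)
      finally show "s \<in> B" unfolding B_def using \<open>s \<in> q\<close> by blast
    qed
    ultimately have AB: "A \<subseteq> B" unfolding S(2) by (rule generated_algebra_least)
    have "D y \<in> q" if "y \<in> q" for y
    proof -
      obtain a b where ab: "a \<in> A" "b \<in> A" "b \<notin> M" "y = a / b"
        using \<open>y \<in> q\<close> M(2) unfolding localization_def by blast
      have "b \<noteq> 0" using ab maximal_idealD(2)[OF M(1)] by auto
      have "b \<in> q" "b \<notin> nonunits q" using ab loc by auto
      hence inv: "inverse b \<in> q" by (simp add: nonunits_def)
      have "D a = D y * b + y * D b" using Dmult[of y b] ab(4) \<open>b \<noteq> 0\<close> by simp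
      hence "D y = (D a - y * D b) * inverse b" using \<open>b \<noteq> 0\<close> by (simp add: field_simps)
      also have "\<dots> \<in> q" using AB ab \<open>y \<in> q\<close> inv unfolding B_def by (intro R_mult R_diff) auto
      finally show ?thesis .
    qed
    thus False using q by blast
  qed
  moreover have "finite (\<Union>s\<in>S. {q \<in> affine_points A. w s \<in> nonunits q})"
    using S(1) P(2) by (intro finite_UN_I finite_zeros_affine[OF A _ reg]) (auto simp: w_def)
  ultimately show ?thesis using finite_subset by blast
qed

end

section \<open>Complete varieties and constants\<close>

context function_field
begin

text \<open>Chevalley's argument. If neither \<open>g\<close> nor \<open>1/g\<close> is in \<open>A\<close>, maximality makes \<open>1\<close> a polynomial
  in \<open>g\<close>, and also one in \<open>1/g\<close>, with coefficients in \<open>s A\<close>; infinite descent on the degrees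
  excludes this.\<close>
lemma maximal_avoiding_valuation_ring:
  assumes A: "subalgebra \<iota> A" and s: "s \<in> A" "s \<noteq> 0" "inverse s \<notin> A"
    and max: "\<And>B. subalgebra \<iota> B \<Longrightarrow> A \<subseteq> B \<Longrightarrow> inverse s \<notin> B \<Longrightarrow> B = A"
  shows "valuation_ring \<iota> A"
proof -
  have add: "\<And>u v. u \<in> A \<Longrightarrow> v \<in> A \<Longrightarrow> u + v \<in> A" and mult: "\<And>u v. u \<in> A \<Longrightarrow> v \<in> A \<Longrightarrow> u * v \<in> A"
    and const: "\<And>c. \<iota> c \<in> A"
    using A by (auto simp: subalgebra_def)
  note zero = subalgebra_0[OF A] and one = subalgebra_1[OF A] and uminus = subalgebra_uminus[OF A]
  have diff: "\<And>u v. u \<in> A \<Longrightarrow> v \<in> A \<Longrightarrow> u - v \<in> A" using add uminus by (metis diff_conv_add_uminus)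
  have power: "u ^ n \<in> A" if "u \<in> A" for u n using that by (induction n) (auto intro: one mult)
  define Po where "Po = {P. \<forall>i. coeff P i \<in> A}"
  have Po_add: "P + Q \<in> Po" if "P \<in> Po" "Q \<in> Po" for P Q
    using that by (auto simp: Po_def intro: add)
  have sumA: "(\<Sum>i\<in>I. h i) \<in> A" if "\<And>i. i \<in> I \<Longrightarrow> h i \<in> A" for h and I :: "nat set"
    using that by (induction I rule: infinite_finite_induct) (auto intro: zero add)
  have Po_mult: "P * Q \<in> Po" if "P \<in> Po" "Q \<in> Po" for P Q
    using that by (auto simp: Po_def coeff_mult intro!: sumA mult)
  have Po_const: "[:a:] \<in> Po" if "a \<in> A" for a
    using that zero by (auto simp: Po_def coeff_pCons split: nat.splits)
  have Po_monom: "monom a n \<in> Po" if "a \<in> A" for a n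
    using that zero by (auto simp: Po_def)

  \<comment> \<open>Adjoining an element outside \<open>A\<close> makes \<open>1/s\<close> appear.\<close>
  have relation: "\<exists>P\<in>Po. 1 = s * poly P g" if "g \<notin> A" for g
  proof (rule ccontr)
    assume no: "\<not> (\<exists>P\<in>Po. 1 = s * poly P g)"
    define B where "B = (\<lambda>P. poly P g) ` Po"
    have "subalgebra \<iota> B"
      unfolding subalgebra_def B_def
    proof (intro conjI ballI subsetI)
      fix a assume "a \<in> range \<iota>"
      thus "a \<in> (\<lambda>P. poly P g) ` Po" using Po_const const by (intro image_eqI[of _ _ "[:a:]"]) auto
    next
      fix a b assume "a \<in> (\<lambda>P. poly P g) ` Po" "b \<in> (\<lambda>P. poly P g) ` Po"
      then obtain P Q where PQ: "P \<in> Po" "Q \<in> Po" "a = poly P g" "b = poly Q g" by blast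
      hence "a + b = poly (P + Q) g" "a * b = poly (P * Q) g" by simp_all
      thus "a + b \<in> (\<lambda>P. poly P g) ` Po" "a * b \<in> (\<lambda>P. poly P g) ` Po"
        using Po_add[OF PQ(1,2)] Po_mult[OF PQ(1,2)] by blast+
    qed
    moreover have "A \<subseteq> B" unfolding B_def
    proof
      fix a assume "a \<in> A"
      thus "a \<in> (\<lambda>P. poly P g) ` Po" using Po_const by (intro image_eqI[of _ _ "[:a:]"]) auto
    qed
    moreover have "inverse s \<notin> B"
    proof
      assume "inverse s \<in> B"
      then obtain P where "P \<in> Po" "inverse s = poly P g" unfolding B_def by blast
      thus False using no s(2) by (metis right_inverse)
    qed
    ultimately have "B = A" using max by blast
    moreover have "g \<in> B"
      unfolding B_def using Po_monom[OF one, of 1] by (intro image_eqI[of _ _ "monom 1 1"]) (auto simp: poly_monom)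
    ultimately show False using that by blast
  qed

  \<comment> \<open>Elements of \<open>1 + s A\<close> are units.\<close>
  have unit: "inverse (1 - s * b) \<in> A" "1 - s * b \<noteq> 0" if "b \<in> A" for b
  proof -
    define u where "u = 1 - s * b"
    have uA: "u \<in> A" unfolding u_def by (intro diff one mult s that)
    show "u \<noteq> 0"
    proof
      assume "u = 0"
      hence "inverse s = b" using s(2) by (simp add: u_def inverse_unique)
      thus False using s that by simp
    qed
    have pow: "\<exists>d\<in>A. u ^ n = 1 - s * d" for n
    proof (induction n)
      case (Suc n)
      then obtain d where d: "d \<in> A" "u ^ n = 1 - s * d" by blast
      have "u ^ Suc n = 1 - s * (b + d - s * b * d)" unfolding power_Suc d(2) by (simp add: u_def algebra_simps)
      moreover have "b + d - s * b * d \<in> A" by (intro diff add mult d s that)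
      ultimately show ?case by blast
    qed (use zero in auto)
    define B where "B = {a / u ^ n | a n. a \<in> A}"
    have "subalgebra \<iota> B"
      unfolding subalgebra_def
    proof (intro conjI ballI subsetI)
      fix a assume "a \<in> range \<iota>"
      hence "a / u ^ 0 \<in> B" unfolding B_def using const by blast
      thus "a \<in> B" by simp
    next
      fix v w assume "v \<in> B" "w \<in> B"
      then obtain a m c n where vw: "a \<in> A" "c \<in> A" "v = a / u ^ m" "w = c / u ^ n"
        unfolding B_def by blast
      have "v + w = (a * u ^ n + c * u ^ m) / u ^ (m + n)"
        using \<open>u \<noteq> 0\<close> by (simp add: vw add_frac_eq power_add)
      moreover have "a * u ^ n + c * u ^ m \<in> A" by (intro add mult power uA vw)
      ultimately show "v + w \<in> B" unfolding B_def by blast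
      have "v * w = (a * c) / u ^ (m + n)" by (simp add: vw power_add)
      moreover have "a * c \<in> A" by (intro mult vw)
      ultimately show "v * w \<in> B" unfolding B_def by blast
    qed
    moreover have "A \<subseteq> B"
    proof
      fix a assume "a \<in> A"
      hence "a / u ^ 0 \<in> B" unfolding B_def by blast
      thus "a \<in> B" by simp
    qed
    moreover have "inverse s \<notin> B"
    proof
      assume "inverse s \<in> B"
      then obtain a n where an: "a \<in> A" "inverse s = a / u ^ n" unfolding B_def by blast
      obtain d where d: "d \<in> A" "u ^ n = 1 - s * d" using pow by blast
      have "u ^ n = s * a" using an(2) s(2) \<open>u \<noteq> 0\<close> by (simp add: field_simps)
      hence "s * (a + d) = 1" using d by (simp add: algebra_simps)
      hence "inverse s = a + d" by (rule inverse_unique)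
      thus False using s(3) add an(1) d(1) by simp
    qed
    ultimately have "B = A" using max by blast
    have "1 / u ^ 1 \<in> B" unfolding B_def using one by blast
    thus "inverse u \<in> A" using \<open>B = A\<close> by (simp add: inverse_eq_divide)
  qed

  \<comment> \<open>A relation for \<open>1/g\<close> of degree at most \<open>n\<close> rewrites \<open>g ^ n\<close> by lower powers, so it lowers
    the degree of a relation for \<open>g\<close>.\<close>
  have descent: "\<exists>P'\<in>Po. 1 = s * poly P' g \<and> degree P' < degree P"
    if P: "P \<in> Po" "1 = s * poly P g" and Q: "Q \<in> Po" "1 = s * poly Q (inverse g)"
      and le: "degree Q \<le> degree P" and g: "g \<noteq> 0" for P Q g
  proof -
    define n where "n = degree P"
    define b where "b = coeff Q 0"
    define v where "v = inverse (1 - s * b)"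
    have bA: "b \<in> A" using Q by (simp add: b_def Po_def)
    have vA: "v \<in> A" and v: "v * (1 - s * b) = 1" using unit[OF bA] by (simp_all add: v_def)
    have "n \<noteq> 0"
    proof
      assume "n = 0"
      then obtain a where "P = [:a:]" unfolding n_def by (metis degree_eq_zeroE)
      moreover have "coeff P 0 \<in> A" using P(1) by (simp add: Po_def)
      ultimately have "s * a = 1" "a \<in> A" using P(2) by simp_all
      thus False using s(3) inverse_unique[of s a] by simp
    qed
    have "s * poly Q (inverse g) = s * (\<Sum>i\<le>n. coeff Q i * inverse g ^ i)"
      unfolding poly_altdef using le
      by (intro arg_cong[of _ _ "(*) s"] sum.mono_neutral_left) (auto simp: n_def coeff_eq_0)
    hence "g ^ n = s * (\<Sum>i\<le>n. coeff Q i * inverse g ^ i) * g ^ n" using Q(2) by simp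
    also have "\<dots> = s * (\<Sum>i\<le>n. coeff Q i * g ^ (n - i))"
    proof -
      have "(\<Sum>i\<le>n. coeff Q i * inverse g ^ i) * g ^ n = (\<Sum>i\<le>n. coeff Q i * g ^ (n - i))"
        unfolding sum_distrib_right
      proof (rule sum.cong)
        fix i assume "i \<in> {..n}"
        hence "inverse g ^ i * g ^ n = g ^ (n - i)"
          using g by (simp add: power_diff field_simps)
        thus "coeff Q i * inverse g ^ i * g ^ n = coeff Q i * g ^ (n - i)" by (simp only: mult.assoc)
      qed simp
      thus ?thesis by (simp only: mult.assoc)
    qed
    also have "(\<Sum>i\<le>n. coeff Q i * g ^ (n - i)) = b * g ^ n + (\<Sum>i\<in>{1..n}. coeff Q i * g ^ (n - i))"
      by (simp add: atMost_atLeast0 sum.atLeast_Suc_atMost b_def)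
    finally have "(1 - s * b) * g ^ n = s * (\<Sum>i\<in>{1..n}. coeff Q i * g ^ (n - i))"
      by (simp add: algebra_simps)
    hence gn: "g ^ n = v * s * (\<Sum>i\<in>{1..n}. coeff Q i * g ^ (n - i))"
    proof -
      have "v * ((1 - s * b) * g ^ n) = v * (s * (\<Sum>i\<in>{1..n}. coeff Q i * g ^ (n - i)))"
        by (rule arg_cong) fact
      thus ?thesis using v by (simp flip: mult.assoc)
    qed
    define P1 where "P1 = (\<Sum>i<n. monom (coeff P i) i)"
    define Q1 where "Q1 = (\<Sum>i\<in>{1..n}. monom (coeff Q i) (n - i))"
    define P' where "P' = P1 + [:coeff P n * v * s:] * Q1"
    have sumPo: "(\<Sum>i\<in>I. h i) \<in> Po" if "\<And>i. i \<in> I \<Longrightarrow> h i \<in> Po" for h and I :: "nat set"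
      using that
    proof (induction I rule: infinite_finite_induct)
      case (insert x F)
      thus ?case by (simp add: Po_add)
    qed (use zero in \<open>auto simp: Po_def\<close>)
    have coeffs: "coeff P i \<in> A" "coeff Q i \<in> A" for i
      using P(1) Q(1) by (simp_all add: Po_def)
    have "P1 \<in> Po" "Q1 \<in> Po"
      unfolding P1_def Q1_def by (intro sumPo Po_monom coeffs)+
    moreover have "coeff P n * v * s \<in> A" by (intro mult coeffs vA s)
    ultimately have "P' \<in> Po" unfolding P'_def by (intro Po_add Po_mult Po_const)
    moreover have "1 = s * poly P' g"
    proof -
      have "poly P g = (\<Sum>i\<le>n. coeff P i * g ^ i)" by (simp add: poly_altdef n_def)
      also have "\<dots> = poly P1 g + coeff P n * g ^ n"
        by (simp add: P1_def poly_sum poly_monom lessThan_Suc_atMost[symmetric])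
      also have "\<dots> = poly P' g"
        by (subst gn) (simp add: P'_def Q1_def poly_sum poly_monom mult_ac)
      finally show ?thesis using P(2) by simp
    qed
    moreover have "degree P' < n"
    proof -
      have "degree P1 \<le> n - 1"
        unfolding P1_def by (rule degree_sum_le) (auto intro: order.trans[OF degree_monom_le])
      moreover have "degree Q1 \<le> n - 1"
        unfolding Q1_def by (rule degree_sum_le) (auto intro: order.trans[OF degree_monom_le])
      ultimately have "degree P' \<le> n - 1"
        unfolding P'_def by (intro degree_add_le) (auto intro: order.trans[OF degree_smult_le])
      thus ?thesis using \<open>n \<noteq> 0\<close> by simp
    qed
    ultimately show ?thesis by (auto simp: n_def)
  qed

  show ?thesis
    unfolding valuation_ring_def
  proof (intro conjI allI impI A, rule ccontr)
    fix g assume g: "g \<noteq> 0" "\<not> (g \<in> A \<or> inverse g \<in> A)"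
    have False if "P \<in> Po" "1 = s * poly P g" "Q \<in> Po" "1 = s * poly Q (inverse g)" for P Q
      using that
    proof (induction "degree P + degree Q" arbitrary: P Q rule: less_induct)
      case less
      show False
      proof (cases "degree Q \<le> degree P")
        case True
        then obtain P' where "P' \<in> Po" "1 = s * poly P' g" "degree P' < degree P"
          using descent[OF less.prems(1,2,3,4)] g(1) by blast
        thus False using less.hyps[of P' Q] less.prems by simp
      next
        case False
        then obtain Q' where "Q' \<in> Po" "1 = s * poly Q' (inverse g)" "degree Q' < degree Q"
          using descent[of Q "inverse g" P] less.prems g(1) by auto
        thus False using less.hyps[of P Q'] less.prems by simp
      qed
    qed
    moreover obtain P where "P \<in> Po" "1 = s * poly P g" using relation g by blast
    moreover obtain Q where "Q \<in> Po" "1 = s * poly Q (inverse g)" using relation g by blast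
    ultimately show False by blast
  qed
qed

lemma exists_valuation_ring:
  assumes h: "h \<notin> range \<iota>"
  obtains V where "valuation_ring \<iota> V" "h \<notin> V"
proof -
  define s where "s = inverse h"
  have s: "s \<noteq> 0" "inverse s = h" using h by (auto simp: s_def)
  define F where "F = {A. subalgebra \<iota> A \<and> s \<in> A \<and> h \<notin> A}"
  have "\<exists>M\<in>F. \<forall>X\<in>F. M \<subseteq> X \<longrightarrow> X = M"
  proof (rule subset_Zorn_nonempty)
    have sub: "subalgebra \<iota> (range (\<lambda>P. peval P s))"
      unfolding subalgebra_def
    proof (intro conjI ballI subsetI)
      fix a assume "a \<in> range \<iota>"
      then obtain c where "a = peval [:c:] s" by auto
      thus "a \<in> range (\<lambda>P. peval P s)" by blast
    next
      fix a b assume "a \<in> range (\<lambda>P. peval P s)" "b \<in> range (\<lambda>P. peval P s)"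
      then obtain P Q where "a = peval P s" "b = peval Q s" by blast
      hence "a + b = peval (P + Q) s" "a * b = peval (P * Q) s" by simp_all
      thus "a + b \<in> range (\<lambda>P. peval P s)" "a * b \<in> range (\<lambda>P. peval P s)" by blast+
    qed
    have "s = peval [:0, 1:] s" by simp
    hence "s \<in> range (\<lambda>P. peval P s)" by blast
    moreover have "h \<notin> range (\<lambda>P. peval P s)"
    proof
      assume "h \<in> range (\<lambda>P. peval P s)"
      then obtain P where "h = peval P s" by blast
      hence "s * peval P s = 1" using s by (metis right_inverse)
      hence "peval (pCons (- 1) P) s = 0" by simp
      then obtain c where "s = \<iota> c" using algebraic_imp_const[of "pCons (- 1) P" s] by auto
      hence "c \<noteq> 0" using s by auto
      have "s * \<iota> (inverse c) = 1" using \<open>s = \<iota> c\<close> \<open>c \<noteq> 0\<close> by (simp flip: \<iota>_mult)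
      hence "h = \<iota> (inverse c)" using s(2) inverse_unique by metis
      thus False using h by blast
    qed
    ultimately have "range (\<lambda>P. peval P s) \<in> F" using sub unfolding F_def by blast
    thus "F \<noteq> {}" by blast
  next
    fix \<C> assume ne: "\<C> \<noteq> {}" and ch: "subset.chain F \<C>"
    have mem: "subalgebra \<iota> X" "s \<in> X" "h \<notin> X" if "X \<in> \<C>" for X
      using that ch by (auto simp: subset.chain_def F_def)
    have linear: "X \<subseteq> Y \<or> Y \<subseteq> X" if "X \<in> \<C>" "Y \<in> \<C>" for X Y
      using that ch by (auto simp: subset.chain_def)
    obtain X where X: "X \<in> \<C>" using ne by blast
    have "subalgebra \<iota> (\<Union>\<C>)"
      unfolding subalgebra_def
    proof (intro conjI ballI)
      have "range \<iota> \<subseteq> X" using mem(1)[OF X] by (simp add: subalgebra_def)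
      thus "range \<iota> \<subseteq> \<Union>\<C>" using X by blast
    next
      fix a b assume "a \<in> \<Union>\<C>" "b \<in> \<Union>\<C>"
      then obtain Y Z where YZ: "Y \<in> \<C>" "Z \<in> \<C>" "a \<in> Y" "b \<in> Z" by blast
      then obtain W where W: "W \<in> \<C>" "a \<in> W" "b \<in> W"
        using linear[OF YZ(1,2)] by blast
      have "a + b \<in> W" "a * b \<in> W"
        using mem(1)[OF W(1)] W(2,3) by (simp_all add: subalgebra_def)
      thus "a + b \<in> \<Union>\<C>" "a * b \<in> \<Union>\<C>" using W(1) by blast+
    qed
    moreover have "s \<in> \<Union>\<C>" using mem(2)[OF X] X by blast
    moreover have "h \<notin> \<Union>\<C>" using mem(3) by blast
    ultimately show "\<Union>\<C> \<in> F" unfolding F_def by blast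
  qed
  then obtain M where M: "M \<in> F" "\<And>X. X \<in> F \<Longrightarrow> M \<subseteq> X \<Longrightarrow> X = M" by blast
  have "valuation_ring \<iota> M"
  proof (rule maximal_avoiding_valuation_ring[of M s])
    fix B assume "subalgebra \<iota> B" "M \<subseteq> B" "inverse s \<notin> B"
    thus "B = M" using M s unfolding F_def by blast
  qed (use M s in \<open>auto simp: F_def\<close>)
  thus thesis using that M unfolding F_def by blast
qed

lemma regular_everywhere_imp_const:
  assumes "complete_variety \<iota> C" "\<And>q. q \<in> C \<Longrightarrow> h \<in> q"
  shows "h \<in> range \<iota>"
proof (rule ccontr)
  assume "h \<notin> range \<iota>"
  then obtain V where V: "valuation_ring \<iota> V" "h \<notin> V" using exists_valuation_ring by blast
  then obtain q where "q \<in> C" "dominates V q" using assms(1) unfolding complete_variety_def by blast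
  thus False using assms(2) V unfolding dominates_def by blast
qed

end

section \<open>Riemann's inequality and the degree of poles\<close>

text \<open>A complete curve, presented by Laurent expansions \<open>E q\<close> at its points; \<open>E q\<close> is
  unconstrained for \<open>q\<close> outside \<open>C\<close>.\<close>
locale expanded_curve = function_field \<iota> for \<iota> :: "complex \<Rightarrow> 'k::field" +
  fixes C :: "'k set set" and t :: "'k set \<Rightarrow> 'k" and E :: "'k set \<Rightarrow> 'k \<Rightarrow> complex fls"
  assumes expansion_at: "q \<in> C \<Longrightarrow> laurent_expansion \<iota> q (t q) (E q)"
    and complete: "complete_variety \<iota> C"
    and finite_zeros: "g \<noteq> 0 \<Longrightarrow> finite {q \<in> C. 0 < fls_subdegree (E q g)}"
begin

abbreviation ord :: "'k set \<Rightarrow> 'k \<Rightarrow> int" where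
  "ord q g \<equiv> fls_subdegree (E q g)"

lemma finite_poles: "finite {q \<in> C. ord q g < 0}"
proof (cases "g = 0")
  case True
  have "{q \<in> C. ord q g < 0} = {}"
    using laurent_expansion.E_0[OF expansion_at] True by auto
  thus ?thesis by (simp only: finite.emptyI)
next
  case False
  have "{q \<in> C. ord q g < 0} = {q \<in> C. 0 < ord q (inverse g)}"
    using laurent_expansion.E_inverse[OF expansion_at]
      laurent_expansion.subdegree_E_inverse[OF expansion_at] by auto
  thus ?thesis using finite_zeros[of "inverse g"] False by simp
qed

text \<open>The Riemann-Roch space \<open>L(D)\<close> of an effective divisor, a multiset of points.\<close>
definition rr_space :: "'k set multiset \<Rightarrow> 'k set" where
  "rr_space D = {h. \<forall>q\<in>C. - int (count D q) \<le> ord q h}"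

lemma rr_spaceD: "h \<in> rr_space D \<Longrightarrow> q \<in> C \<Longrightarrow> - int (count D q) \<le> ord q h"
  unfolding rr_space_def by blast

lemma rr_space_mono: "D \<subseteq># D' \<Longrightarrow> rr_space D \<subseteq> rr_space D'"
proof
  fix h assume "D \<subseteq># D'" "h \<in> rr_space D"
  have "- int (count D' q) \<le> ord q h" if "q \<in> C" for q
    using rr_spaceD[OF \<open>h \<in> rr_space D\<close> that] mset_subset_eq_count[OF \<open>D \<subseteq># D'\<close>, of q] by linarith
  thus "h \<in> rr_space D'" unfolding rr_space_def by blast
qed

lemma rr_space_1: "1 \<in> rr_space D"
  unfolding rr_space_def using laurent_expansion.E_1[OF expansion_at] by auto

lemma rr_space_mult:
  assumes "g \<in> rr_space D" "h \<in> rr_space D'"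
  shows "g * h \<in> rr_space (D + D')"
  unfolding rr_space_def
proof (intro CollectI ballI)
  fix q assume q: "q \<in> C"
  interpret laurent_expansion \<iota> q "t q" "E q" by (rule expansion_at) fact
  show "- int (count (D + D') q) \<le> ord q (g * h)"
    using rr_spaceD[OF assms(1) q] rr_spaceD[OF assms(2) q] by (cases "g = 0 \<or> h = 0") auto
qed

lemma rr_space_power: "g \<in> rr_space D \<Longrightarrow> g ^ n \<in> rr_space (repeat_mset n D)"
  by (induction n) (auto simp: rr_space_1 dest: rr_space_mult)

lemma rr_space_cancel:
  assumes "g \<in> rr_space D" "h \<in> rr_space D"
  shows "g - \<iota> c * h \<in> rr_space D"
  unfolding rr_space_def
proof (intro CollectI ballI)
  fix q assume q: "q \<in> C"
  interpret laurent_expansion \<iota> q "t q" "E q" by (rule expansion_at) fact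
  have "- int (count D q) \<le> fls_subdegree (fls_const c * E q h)"
    using rr_spaceD[OF assms(2) q] by (cases "h = 0 \<or> c = 0") auto
  thus "- int (count D q) \<le> ord q (g - \<iota> c * h)"
    using rr_spaceD[OF assms(1) q] by (simp add: fls_subdegree_diff_ge)
qed

lemma rr_space_empty: "h \<in> rr_space {#} \<Longrightarrow> h \<in> range \<iota>"
  using regular_everywhere_imp_const[OF complete] rr_spaceD[of h "{#}"]
    laurent_expansion.R_iff[OF expansion_at] by simp

text \<open>The orders at \<open>p\<close> of the nonzero functions in \<open>L(D)\<close>.\<close>
definition rr_orders :: "'k set \<Rightarrow> 'k set multiset \<Rightarrow> int set" where
  "rr_orders p D = {ord p h | h. h \<in> rr_space D \<and> h \<noteq> 0}"

text \<open>Riemann's inequality \<open>dim L(D) \<le> deg D + 1\<close>: as the orders at \<open>p\<close> of a space of functions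
  are as many as its dimension, it is enough that allowing one more pole at \<open>q\<close> creates at most
  one new order. Of two functions with new orders, a combination loses the extra pole at \<open>q\<close>
  and keeps the smaller order.\<close>
lemma card_rr_orders:
  assumes p: "p \<in> C" and D: "set_mset D \<subseteq> C"
  shows "finite (rr_orders p D) \<and> card (rr_orders p D) \<le> size D + 1"
  using D
proof (induction D)
  case empty
  interpret laurent_expansion \<iota> p "t p" "E p" by (rule expansion_at) fact
  have "rr_orders p {#} \<subseteq> {0}"
    unfolding rr_orders_def using rr_space_empty by fastforce
  thus ?case using finite_subset[of _ "{0 :: int}"] card_mono[of "{0 :: int}"] by force
next
  case (add q D)
  hence q: "q \<in> C" by simp
  interpret p: laurent_expansion \<iota> p "t p" "E p" by (rule expansion_at) fact
  interpret q: laurent_expansion \<iota> q "t q" "E q" by (rule expansion_at) fact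
  define N where "N = rr_orders p (add_mset q D) - rr_orders p D"
  have top: "ord q h = - int (count D q) - 1"
    if "h \<in> rr_space (add_mset q D)" "h \<notin> rr_space D" for h
  proof -
    have "- int (count D r) \<le> ord r h" if "r \<in> C" "r \<noteq> q" for r
      using rr_spaceD[OF \<open>h \<in> rr_space (add_mset q D)\<close> \<open>r \<in> C\<close>] that(2) by simp
    hence "\<not> - int (count D q) \<le> ord q h"
      using that(2) unfolding rr_space_def by blast
    thus ?thesis using rr_spaceD[OF that(1) q] by simp
  qed
  have less: False if ij: "i \<in> N" "j \<in> N" "i < j" for i j
  proof -
    obtain g h where gh: "g \<in> rr_space (add_mset q D)" "g \<noteq> 0" "i = ord p g"
      "h \<in> rr_space (add_mset q D)" "h \<noteq> 0" "j = ord p h"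
      using ij unfolding N_def rr_orders_def by blast
    have new: "g \<notin> rr_space D" "h \<notin> rr_space D"
      using ij gh unfolding N_def rr_orders_def by blast+
    obtain c where c: "g - \<iota> c * h = 0 \<or> ord q g < ord q (g - \<iota> c * h)"
      using q.cancel_leading_term[OF gh(2,5)] top[OF gh(1) new(1)] top[OF gh(4) new(2)] by metis
    define f where "f = g - \<iota> c * h"
    have f: "ord p f = i"
    proof (cases "c = 0")
      case False
      hence j: "ord p (\<iota> c * h) = j" using gh by simp
      have "E p (\<iota> c * h) $$ k = 0" if "k \<le> i" for k
        by (rule fls_eq0_below_subdegree) (use ij(3) that j in linarith)
      moreover have "E p g $$ i \<noteq> 0" using gh(2,3) by simp
      ultimately show ?thesis
        by (intro fls_subdegree_eqI) (auto simp: f_def gh(3) simp del: p.E_mult)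
    qed (use gh in \<open>simp add: f_def\<close>)
    have "f \<noteq> 0"
    proof
      assume "f = 0"
      hence "g = \<iota> c * h" by (simp add: f_def)
      hence "i = j" using gh by (auto split: if_splits)
      thus False using ij by simp
    qed
    have fs: "f \<in> rr_space (add_mset q D)" unfolding f_def using gh by (intro rr_space_cancel)
    have "f \<in> rr_space D"
    proof (rule ccontr)
      assume "f \<notin> rr_space D"
      from top[OF fs this] show False
        using c top[OF gh(1) new(1)] \<open>f \<noteq> 0\<close> by (simp add: f_def)
    qed
    hence "i \<in> rr_orders p D" using f \<open>f \<noteq> 0\<close> unfolding rr_orders_def by blast
    thus False using ij unfolding N_def by blast
  qed
  hence "N = {} \<or> (\<exists>i. N = {i})" by (metis empty_iff insertI1 linorder_neqE equalityI singletonD subsetI)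
  hence N: "finite N \<and> card N \<le> 1" by auto
  have sub: "rr_orders p (add_mset q D) \<subseteq> rr_orders p D \<union> N" unfolding N_def by blast
  have IH: "finite (rr_orders p D)" "card (rr_orders p D) \<le> size D + 1" using add by auto
  have "finite (rr_orders p D \<union> N)" using N IH by blast
  moreover have "card (rr_orders p D \<union> N) \<le> size D + 1 + 1"
    using card_Un_le[of "rr_orders p D" N] N IH by linarith
  ultimately show ?case
    using finite_subset[OF sub] card_mono[OF _ sub] by fastforce
qed

lemma pole_divisor:
  obtains D where "set_mset D \<subseteq> C" "g \<in> rr_space D"
proof -
  define Q where "Q = {q \<in> C. ord q g < 0}"
  define D where "D = (\<Sum>q\<in>Q. replicate_mset (nat (- ord q g)) q)"
  have fin: "finite Q" unfolding Q_def by (rule finite_poles)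
  have cnt: "count D r = (if r \<in> Q then nat (- ord r g) else 0)" for r
    using fin by (simp add: D_def count_sum count_replicate_mset if_distrib cong: if_cong)
  show thesis
  proof (rule that[of D])
    show "set_mset D \<subseteq> C"
      using cnt by (auto simp: Q_def simp flip: count_greater_zero_iff split: if_splits)
    show "g \<in> rr_space D" unfolding rr_space_def using cnt by (auto simp: Q_def)
  qed
qed

text \<open>The functions \<open>g\<^sup>j t\<^sup>i\<close> for \<open>j \<le> k\<close> and \<open>i < m\<close>, where \<open>m\<close> is the order of \<open>g\<close> at \<open>p\<close>, have
  distinct orders \<open>m j + i\<close> at \<open>p\<close> and lie in \<open>L(k D + m F)\<close>, where \<open>F\<close> bounds the poles of \<open>t\<close>.
  Riemann's inequality for large \<open>k\<close> gives \<open>m \<le> deg D\<close>.\<close>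
lemma order_le_degree:
  assumes p: "p \<in> C" and g: "g \<noteq> 0" "g \<in> rr_space D" and D: "set_mset D \<subseteq> C"
  shows "ord p g \<le> int (size D)"
proof (rule ccontr)
  assume contra: "\<not> ord p g \<le> int (size D)"
  interpret laurent_expansion \<iota> p "t p" "E p" by (rule expansion_at) fact
  define m where "m = nat (ord p g)"
  have m: "ord p g = int m" "size D < m" using contra by (auto simp: m_def)
  obtain F where F: "set_mset F \<subseteq> C" "t p \<in> rr_space F" using pole_divisor by blast
  define k where "k = m * size F + 1"
  define B where "B = repeat_mset k D + repeat_mset m F"
  have "{0..<int (m * (k + 1))} \<subseteq> rr_orders p B"
  proof
    fix z assume z: "z \<in> {0..<int (m * (k + 1))}"
    define n where "n = nat z"
    have n: "z = int n" "n < m * (k + 1)"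
      using z by (simp_all only: n_def atLeastLessThan_iff nat_less_iff int_nat_eq if_True)
    define h where "h = g ^ (n div m) * t p ^ (n mod m)"
    have "ord p h = int (n div m) * int m + int (n mod m)"
      using g by (simp add: h_def m fls_subdegree_pow del: of_nat_div of_nat_mod)
    also have "\<dots> = int n" by (metis div_mult_mod_eq of_nat_add of_nat_mult)
    finally have "ord p h = z" by (simp add: n)
    moreover have "h \<noteq> 0" using g by (simp add: h_def)
    moreover have "h \<in> rr_space B"
    proof -
      have "n div m < k + 1" using n m by (simp add: less_mult_imp_div_less mult.commute)
      hence le: "n div m \<le> k" "n mod m \<le> m" using m by auto
      have "repeat_mset (n div m) D + repeat_mset (n mod m) F \<subseteq># B"
        unfolding B_def using le by (intro subset_mset.add_mono) (auto simp: subseteq_mset_def)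
      moreover have "h \<in> rr_space (repeat_mset (n div m) D + repeat_mset (n mod m) F)"
        unfolding h_def using g F by (intro rr_space_mult rr_space_power)
      ultimately show ?thesis using rr_space_mono by blast
    qed
    ultimately show "z \<in> rr_orders p B" unfolding rr_orders_def by blast
  qed
  moreover have "set_mset B \<subseteq> C"
  proof
    fix x assume "x \<in># B"
    hence "0 < count D x \<or> 0 < count F x" by (auto simp: B_def simp flip: count_greater_zero_iff)
    thus "x \<in> C" using D F by (auto simp: count_greater_zero_iff)
  qed
  ultimately have "card {0..<int (m * (k + 1))} \<le> size B + 1"
    using card_rr_orders[OF p, of B] card_mono order.trans by blast
  moreover have "card {0..<int (m * (k + 1))} = m * (k + 1)"
    by (simp only: card_atLeastLessThan_int diff_zero nat_int)
  ultimately have "m * (k + 1) \<le> k * size D + m * size F + 1" by (simp add: B_def)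
  moreover have "(size D + 1) * (k + 1) \<le> m * (k + 1)" using m by (intro mult_right_mono) auto
  ultimately show False by (simp add: k_def algebra_simps)
qed

lemma order_le_poles:
  assumes p: "p \<in> C" and "g \<noteq> 0" and Q: "finite Q" "Q \<subseteq> C"
    and d: "\<And>q. q \<in> Q \<Longrightarrow> - int (d q) \<le> ord q g" and "\<And>q. q \<in> C - Q \<Longrightarrow> 0 \<le> ord q g"
  shows "ord p g \<le> int (\<Sum>q\<in>Q. d q)"
proof -
  define D where "D = (\<Sum>q\<in>Q. replicate_mset (d q) q)"
  have cnt: "count D r = (if r \<in> Q then d r else 0)" for r
    using Q by (simp add: D_def count_sum count_replicate_mset if_distrib cong: if_cong)
  have "set_mset D \<subseteq> C"
    using cnt Q by (auto simp flip: count_greater_zero_iff split: if_splits)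
  moreover have "g \<in> rr_space D" unfolding rr_space_def using cnt assms by auto
  moreover have "size D = (\<Sum>q\<in>Q. d q)" by (simp add: D_def size_multiset_sum)
  ultimately show ?thesis using order_le_degree[OF p \<open>g \<noteq> 0\<close>, of D] by simp
qed

end

section \<open>Euler operators and the proof of the bound\<close>

lemma smooth_complete_curve_function_field:
  assumes "smooth_complete_curve \<iota> C"
  shows "function_field \<iota>"
  using assms
  by unfold_locales
    (auto simp: smooth_complete_curve_def algebraic_curve_def transcendence_degree_one_def)

lemma smooth_complete_curve_regular_point:
  assumes C: "smooth_complete_curve \<iota> C" and q: "q \<in> C"
  shows "\<exists>t. regular_point \<iota> q t"
proof -
  interpret function_field \<iota> using C by (rule smooth_complete_curve_function_field)
  obtain A where "affine_coordinate_ring \<iota> A" "q \<in> affine_points A"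
    using C q unfolding smooth_complete_curve_def algebraic_curve_def by blast
  moreover obtain t where "t \<noteq> 0" "nonunits q = {t * g | g. g \<in> q}"
    using C q unfolding smooth_complete_curve_def smooth_curve_def by blast
  ultimately show ?thesis using affine_point_regular by blast
qed

lemma smooth_complete_curve_expansion:
  assumes C: "smooth_complete_curve \<iota> C" and q: "q \<in> C" and s: "local_parameter q s"
  shows "\<exists>E. laurent_expansion \<iota> q s E"
proof -
  obtain t where "regular_point \<iota> q t"
    using smooth_complete_curve_regular_point[OF C q] by blast
  then interpret regular_point \<iota> q t .
  have "regular_point \<iota> q s" using regular_point_parameter s by (simp add: local_parameter_def)
  then interpret s: regular_point \<iota> q s .
  show ?thesis using s.expansion.laurent_expansion_axioms by blast
qed

lemma smooth_complete_curve_charts: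
  assumes C: "smooth_complete_curve \<iota> C"
  obtains \<A> where "finite \<A>" "\<And>A. A \<in> \<A> \<Longrightarrow> affine_coordinate_ring \<iota> A" "C = (\<Union>A\<in>\<A>. affine_points A)"
  using assms unfolding smooth_complete_curve_def algebraic_curve_def by blast

lemma smooth_complete_curve_expanded:
  fixes \<iota> :: "complex \<Rightarrow> 'k::field"
  assumes C: "smooth_complete_curve \<iota> C" and t: "\<forall>q\<in>C. local_parameter q (t q)"
  shows "\<exists>E. expanded_curve \<iota> C t E"
proof -
  interpret function_field \<iota> using C by (rule smooth_complete_curve_function_field)
  have "\<forall>q\<in>C. \<exists>E. laurent_expansion \<iota> q (t q) E"
    using smooth_complete_curve_expansion[OF C] t by blast
  then obtain E where E: "\<And>q. q \<in> C \<Longrightarrow> laurent_expansion \<iota> q (t q) (E q)" by metis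
  obtain \<A> where \<A>: "finite \<A>" "\<And>A. A \<in> \<A> \<Longrightarrow> affine_coordinate_ring \<iota> A"
    "C = (\<Union>A\<in>\<A>. affine_points A)"
    using smooth_complete_curve_charts[OF C] by blast
  have "expanded_curve \<iota> C t E"
  proof (rule expanded_curve.intro[OF function_field_axioms expanded_curve_axioms.intro])
    show "laurent_expansion \<iota> q (t q) (E q)" if "q \<in> C" for q by (rule E) fact
    show "complete_variety \<iota> C" using C by (simp add: smooth_complete_curve_def)
    fix g :: 'k assume "g \<noteq> 0"
    have "{q \<in> C. 0 < fls_subdegree (E q g)} \<subseteq> (\<Union>A\<in>\<A>. {q \<in> affine_points A. g \<in> nonunits q})"
      using laurent_expansion.nonunit_iff[OF E] \<A>(3) by auto
    moreover have "finite (\<Union>A\<in>\<A>. {q \<in> affine_points A. g \<in> nonunits q})"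
    proof (intro finite_UN_I finite_zeros_affine \<A>)
      fix A q assume "A \<in> \<A>" "q \<in> affine_points A"
      thus "\<exists>t. regular_point \<iota> q t" using smooth_complete_curve_regular_point[OF C] \<A>(3) by blast
    qed (use \<open>g \<noteq> 0\<close> in auto)
    ultimately show "finite {q \<in> C. 0 < fls_subdegree (E q g)}" by (rule finite_subset)
  qed
  thus ?thesis by blast
qed

text \<open>A nonconstant function ramifies at finitely many of the points where it is regular, since
  \<open>d/dx\<close> gives the local parameter at such a point a derivative with a pole.\<close>
lemma finite_ramification:
  assumes C: "smooth_complete_curve \<iota> C" and x: "x \<notin> range \<iota>"
    and E: "\<And>q. q \<in> C \<Longrightarrow> laurent_expansion \<iota> q (t q) (E q)"
  shows "finite {q \<in> C. 0 \<le> fls_subdegree (E q x) \<and> 0 < fls_subdegree (fls_deriv (E q x))}"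
proof (cases "C = {}")
  case False
  then obtain r where "r \<in> C" by blast
  interpret r: laurent_expansion \<iota> r "t r" "E r" by (rule E) fact
  obtain \<A> where \<A>: "finite \<A>" "\<And>A. A \<in> \<A> \<Longrightarrow> affine_coordinate_ring \<iota> A"
    "C = (\<Union>A\<in>\<A>. affine_points A)"
    using smooth_complete_curve_charts[OF C] by blast
  have "{q \<in> C. 0 \<le> fls_subdegree (E q x) \<and> 0 < fls_subdegree (fls_deriv (E q x))} \<subseteq>
    (\<Union>A\<in>\<A>. {q \<in> affine_points A. x \<in> q \<and> \<not> ddx \<iota> x ` q \<subseteq> q})"
  proof
    fix q assume q: "q \<in> {q \<in> C. 0 \<le> fls_subdegree (E q x) \<and> 0 < fls_subdegree (fls_deriv (E q x))}"
    interpret laurent_expansion \<iota> q "t q" "E q" by (rule E) (use q in blast)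
    have "x \<in> q" "t q \<in> q" using q by (simp_all add: R_iff)
    moreover have "fls_subdegree (E q (ddx \<iota> x (t q))) < 0"
      using q nonconst_deriv[OF x] by (simp add: E_ddx[OF x] fls_divide_subdegree)
    hence "ddx \<iota> x (t q) \<notin> q" by (simp add: R_iff)
    ultimately show "q \<in> (\<Union>A\<in>\<A>. {q \<in> affine_points A. x \<in> q \<and> \<not> ddx \<iota> x ` q \<subseteq> q})"
      using q \<A>(3) by blast
  qed
  moreover have "finite (\<Union>A\<in>\<A>. {q \<in> affine_points A. x \<in> q \<and> \<not> ddx \<iota> x ` q \<subseteq> q})"
  proof (intro finite_UN_I r.finite_irregular_derivation \<A> x r.ddx_derivation)
    fix A q assume "A \<in> \<A>" "q \<in> affine_points A"
    thus "\<exists>t. regular_point \<iota> q t" using smooth_complete_curve_regular_point[OF C] \<A>(3) by blast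
  qed
  ultimately show ?thesis by (rule finite_subset)
qed simp

text \<open>The operators \<open>\<Prod>\<^bsub>i<n\<^esub> (\<theta> - a\<^sub>i)\<close> with \<open>\<theta> = x d/dx\<close>, applied to \<open>f\<close>. Each factor
  \<open>\<theta> - a\<^sub>i\<close> kills exactly the monomial \<open>x ^ a\<^sub>i\<close>.\<close>
primrec euler_product :: "(complex \<Rightarrow> 'k::field) \<Rightarrow> 'k \<Rightarrow> (nat \<Rightarrow> nat) \<Rightarrow> 'k \<Rightarrow> nat \<Rightarrow> 'k" where
  "euler_product \<iota> x a f 0 = f"
| "euler_product \<iota> x a f (Suc n) =
    x * ddx \<iota> x (euler_product \<iota> x a f n) - \<iota> (of_nat (a n)) * euler_product \<iota> x a f n"

lemma fls_X_deriv_nth: "(fls_X * fls_deriv F) $$ k = of_int k * F $$ k"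
  by (simp add: fls_X_times_conv_shift(1))

lemma (in laurent_expansion) euler_product_nth:
  "E (euler_product \<iota> t a f n) $$ k = (\<Prod>i<n. of_int k - of_nat (a i)) * E f $$ k"
proof (induction n)
  case (Suc n)
  have "E (euler_product \<iota> t a f (Suc n)) =
      fls_X * fls_deriv (E (euler_product \<iota> t a f n)) - fls_const (of_nat (a n)) * E (euler_product \<iota> t a f n)"
    by (simp add: E_ddx_t)
  hence "E (euler_product \<iota> t a f (Suc n)) $$ k =
      (of_int k - of_nat (a n)) * E (euler_product \<iota> t a f n) $$ k"
    by (simp add: fls_X_deriv_nth algebra_simps)
  thus ?case by (simp add: Suc)
qed simp

lemma (in laurent_expansion) sums_in_completion_nth:
  assumes a: "strict_mono a" and f: "sums_in_completion R (\<lambda>n. \<iota> (\<alpha> n) * t ^ a n) f"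
  shows "E f $$ int (a n) = \<alpha> n" and "k \<notin> range (\<lambda>n. int (a n)) \<Longrightarrow> E f $$ k = 0"
proof -
  have E_sum: "E (\<Sum>n<N. u n) = (\<Sum>n<N. E (u n))" for u and N :: nat
    by (induction N) simp_all
  have sum_nth: "E (\<Sum>n<N. \<iota> (\<alpha> n) * t ^ a n) $$ k = (\<Sum>n<N. if k = int (a n) then \<alpha> n else 0)" for N k
    unfolding E_sum by (induction N) auto
  have *: "\<exists>N>M. E f $$ k = (\<Sum>n<N. if k = int (a n) then \<alpha> n else 0)" for k M
  proof -
    have "\<forall>\<^sub>F N in sequentially. ereal (of_int k) < val_at R (f - (\<Sum>n<N. \<iota> (\<alpha> n) * t ^ a n))"
      using f unfolding sums_in_completion_def by (rule order_tendstoD) simp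
    then obtain N0 where N0: "\<forall>N\<ge>N0. ereal (of_int k) < val_at R (f - (\<Sum>n<N. \<iota> (\<alpha> n) * t ^ a n))"
      unfolding eventually_sequentially by blast
    define N where "N = N0 + Suc M"
    have "N > M" "N \<ge> N0" by (simp_all add: N_def)
    hence N: "N > M" "ereal (of_int k) < val_at R (f - (\<Sum>n<N. \<iota> (\<alpha> n) * t ^ a n))"
      using N0 by blast+
    define h where "h = f - (\<Sum>n<N. \<iota> (\<alpha> n) * t ^ a n)"
    have "E h $$ k = 0"
      using N(2) by (cases "h = 0") (simp_all add: val_at_eq flip: h_def)
    hence "E f $$ k = E (\<Sum>n<N. \<iota> (\<alpha> n) * t ^ a n) $$ k" by (simp add: h_def)
    thus ?thesis using N(1) unfolding sum_nth by blast
  qed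
  have inj: "a i = a j \<longleftrightarrow> i = j" for i j using a by (simp add: strict_mono_eq)
  obtain N where "N > n" "E f $$ int (a n) = (\<Sum>m<N. if int (a n) = int (a m) then \<alpha> m else 0)"
    using * by blast
  thus "E f $$ int (a n) = \<alpha> n" by (simp add: inj)
  show "E f $$ k = 0" if "k \<notin> range (\<lambda>n. int (a n))"
  proof -
    obtain N where "E f $$ k = (\<Sum>m<N. if k = int (a m) then \<alpha> m else 0)" using * by blast
    also have "\<dots> = 0" using that by (intro sum.neutral) auto
    finally show ?thesis .
  qed
qed

text \<open>The product kills the first \<open>n\<close> terms of the expansion of \<open>f\<close> in \<open>x\<close> and no other.\<close>
lemma (in laurent_expansion) euler_product_order:
  assumes a: "strict_mono a" and f: "sums_in_completion R (\<lambda>n. \<iota> (\<alpha> n) * t ^ a n) f"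
    and \<alpha>: "\<And>n. \<alpha> n \<noteq> 0"
  shows "euler_product \<iota> t a f n \<noteq> 0" and "fls_subdegree (E (euler_product \<iota> t a f n)) = int (a n)"
proof -
  note nth = sums_in_completion_nth[OF a f]
  have "a i < a n" if "i < n" for i using a that by (simp add: strict_mono_def)
  hence "(\<Prod>i<n. of_int (int (a n)) - of_nat (a i) :: complex) \<noteq> 0"
    by (fastforce simp: prod_zero_iff)
  hence nz: "E (euler_product \<iota> t a f n) $$ int (a n) \<noteq> 0"
    using \<alpha> by (simp add: euler_product_nth nth)
  thus "euler_product \<iota> t a f n \<noteq> 0" by auto
  show "fls_subdegree (E (euler_product \<iota> t a f n)) = int (a n)"
  proof (rule fls_subdegree_eqI[OF nz])
    fix k assume k: "k < int (a n)"
    show "E (euler_product \<iota> t a f n) $$ k = 0"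
    proof (cases "k \<in> range (\<lambda>n. int (a n))")
      case True
      then obtain j where j: "k = int (a j)" by blast
      hence "j < n" using a k by (simp add: strict_mono_less)
      hence "(\<Prod>i<n. of_int k - of_nat (a i) :: complex) = 0" using j by (auto simp: prod_zero_iff)
      thus ?thesis by (simp add: euler_product_nth)
    qed (simp add: euler_product_nth nth)
  qed
qed

text \<open>Each factor \<open>\<theta> - a\<^sub>i\<close> raises the pole order by at most \<open>w\<close>. If \<open>w = 0\<close> is allowed at a point
  with \<open>x\<close> finite, nonzero and unramified, then \<open>f\<close> and all its images are regular there.\<close>
lemma (in laurent_expansion) euler_product_poles:
  fixes w :: nat
  assumes x: "x \<notin> range \<iota>"
    and w: "fls_subdegree (E x) = 0 \<Longrightarrow> 0 < fls_subdegree (fls_deriv (E x)) \<Longrightarrow>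
        fls_subdegree (fls_deriv (E x)) + 1 \<le> int w"
      "fls_subdegree (E f) < 0 \<Longrightarrow> fls_subdegree (fls_deriv (E x)) = 0 \<Longrightarrow> 1 \<le> w"
  shows "- int (nat (- fls_subdegree (E f)) + n * w) \<le> fls_subdegree (E (euler_product \<iota> x a f n))"
proof (induction n)
  case (Suc n)
  define m where "m = int (nat (- fls_subdegree (E f)) + n * w)"
  define g where "g = euler_product \<iota> x a f n"
  have m: "0 \<le> m" "- m \<le> fls_subdegree (E g)" using Suc by (simp_all add: m_def g_def)
  note dx = nonconst_deriv[OF x]
  have "- (m + int w) \<le> fls_subdegree (E x * fls_deriv (E g) / fls_deriv (E x))"
  proof (cases "fls_subdegree (E x) = 0")
    case False
    from euler_operator_zero_or_pole[OF dx False m] show ?thesis by simp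
  next
    case 0: True
    have e: "0 \<le> fls_subdegree (fls_deriv (E x))" using fls_deriv_subdegree0[OF 0] .
    show ?thesis
    proof (cases "fls_subdegree (fls_deriv (E x)) + 1 \<le> int w")
      case True
      with euler_operator_finite_nonzero[OF dx 0 m] show ?thesis by linarith
    next
      case False
      hence e0: "fls_subdegree (fls_deriv (E x)) = 0" using w(1)[OF 0] e by linarith
      have "w = 0" using False e0 by simp
      with w(2) e0 have "0 \<le> fls_subdegree (E f)" by force
      hence "m = 0" using \<open>w = 0\<close> by (simp add: m_def)
      with euler_operator_regular[OF dx 0 e0] m \<open>w = 0\<close> show ?thesis by simp
    qed
  qed
  moreover have "- (m + int w) \<le> fls_subdegree (fls_const (of_nat (a n)) * E g)"
    using m by (cases "g = 0 \<or> a n = 0") auto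
  ultimately have "- (m + int w) \<le>
      fls_subdegree (E x * fls_deriv (E g) / fls_deriv (E x) - fls_const (of_nat (a n)) * E g)"
    using m by (intro fls_subdegree_diff_ge) auto
  thus ?case by (simp add: m_def g_def E_ddx[OF x] algebra_simps)
qed simp

theorem mainTheorem2:
  fixes \<iota> :: "complex \<Rightarrow> 'k::field"
    and C :: "'k set set"
    and p :: "'k set"
    and x f :: 'k
    and \<alpha> :: "nat \<Rightarrow> complex"
    and a :: "nat \<Rightarrow> nat"
    and t :: "'k set \<Rightarrow> 'k"
    and S\<^sub>1 S\<^sub>2 :: "'k set set"
  assumes "smooth_complete_curve \<iota> C"
    and "p \<in> C"
    and "local_parameter p x"
    and "f \<notin> generated_algebra \<iota> {x}"
    and "val_at p f = 0"
    and "\<forall>n. \<alpha> n \<noteq> 0"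
    and "strict_mono a"
    and "a 0 = 0"
    and "sums_in_completion p (\<lambda>n. \<iota> (\<alpha> n) * x ^ a n) f"
    and "\<forall>q\<in>C. local_parameter q (t q)"
    and "S\<^sub>1 = {q \<in> C. val_at q f < 0 \<and> val_at q (ddx \<iota> (t q) x) = 0}"
    and "S\<^sub>2 = {q \<in> C. val_at q x = 0 \<and> val_at q (ddx \<iota> (t q) x) > 0}"
  shows "limsup (\<lambda>n. ereal (real (a n) / real n))
           \<le> ereal (real (card S\<^sub>1)) + (\<Sum>q\<in>S\<^sub>2. val_at q (ddx \<iota> (t q) x) + 1)"
proof -
  note curve = assms(1) and p = assms(2) and S1 = assms(11) and S2 = assms(12)
  obtain E where "expanded_curve \<iota> C t E"
    using smooth_complete_curve_expanded[OF curve assms(10)] by blast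
  then interpret expanded_curve \<iota> C t E .
  obtain E\<^sub>p where "laurent_expansion \<iota> p x E\<^sub>p"
    using smooth_complete_curve_expansion[OF curve p assms(3)] by blast
  then interpret p: laurent_expansion \<iota> p x E\<^sub>p .
  have x: "x \<notin> range \<iota>" by (rule p.t_not_const)
  define e where "e q = fls_subdegree (fls_deriv (E q x))" for q
  have val_dx: "val_at q (ddx \<iota> (t q) x) = ereal (of_int (e q))" if "q \<in> C" for q
    using laurent_expansion.val_at_ddx_t[OF expansion_at[OF that] x] by (simp add: e_def)
  have val: "val_at q g = (if g = 0 then \<infinity> else ereal (of_int (ord q g)))" if "q \<in> C" for q g
    using laurent_expansion.val_at_eq[OF expansion_at[OF that]] .
  have "f \<noteq> 0" using assms(5) val[OF p, of f] by auto
  have "x \<noteq> 0" by (rule p.t_nz)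
  have S1_iff: "q \<in> S\<^sub>1 \<longleftrightarrow> ord q f < 0 \<and> e q = 0" if "q \<in> C" for q
    using that \<open>f \<noteq> 0\<close> by (simp add: S1 val_dx val[of q f])
  have S2_iff: "q \<in> S\<^sub>2 \<longleftrightarrow> ord q x = 0 \<and> 0 < e q" if "q \<in> C" for q
    using that \<open>x \<noteq> 0\<close> by (simp add: S2 val_dx val[of q x])
  have sub: "S\<^sub>1 \<subseteq> C" "S\<^sub>2 \<subseteq> C" using S1 S2 by auto
  have "S\<^sub>1 \<subseteq> {q \<in> C. ord q f < 0}" using sub S1_iff by blast
  hence fin1: "finite S\<^sub>1" using finite_poles finite_subset by blast
  have "S\<^sub>2 \<subseteq> {q \<in> C. 0 \<le> ord q x \<and> 0 < e q}" using sub S2_iff by auto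
  hence fin2: "finite S\<^sub>2"
    using finite_ramification[OF curve x expansion_at] finite_subset unfolding e_def by blast
  have disj: "S\<^sub>1 \<inter> S\<^sub>2 = {}" using sub S1_iff S2_iff by auto

  \<comment> \<open>The growth of the pole at \<open>q\<close> under one factor \<open>\<theta> - a\<^sub>i\<close>.\<close>
  define w where "w q = (if q \<in> S\<^sub>2 then nat (e q + 1) else if q \<in> S\<^sub>1 then 1 else 0)" for q
  define Q where "Q = {q \<in> C. ord q f < 0} \<union> (S\<^sub>1 \<union> S\<^sub>2)"
  have Q: "finite Q" "Q \<subseteq> C" using fin1 fin2 sub finite_poles by (auto simp: Q_def)
  define B where "B = (\<Sum>q\<in>Q. nat (- ord q f))"
  define W where "W = (\<Sum>q\<in>Q. w q)"
  have poles: "- int (nat (- ord q f) + n * w q) \<le> ord q (euler_product \<iota> x a f n)"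
    if q: "q \<in> C" for q n
    by (rule laurent_expansion.euler_product_poles[OF expansion_at[OF q] x])
      (use S1_iff[OF q] S2_iff[OF q] in \<open>auto simp: w_def simp flip: e_def\<close>)
  have bound: "a n \<le> B + n * W" for n
  proof -
    define g where "g = euler_product \<iota> x a f n"
    have g: "g \<noteq> 0" "fls_subdegree (E\<^sub>p g) = int (a n)"
      using p.euler_product_order[OF assms(7,9), of n] assms(6) by (auto simp: g_def)
    have "ord p g = int (a n)" using val[OF p, of g] p.val_at_eq[of g] g by simp
    moreover have "ord p g \<le> int (\<Sum>q\<in>Q. nat (- ord q f) + n * w q)"
    proof (rule order_le_poles[OF p g(1) Q])
      show "- int (nat (- ord q f) + n * w q) \<le> ord q g" if "q \<in> Q" for q
        using poles[of q n] that Q by (auto simp: g_def)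
      show "0 \<le> ord q g" if "q \<in> C - Q" for q
      proof -
        have "nat (- ord q f) + n * w q = 0" using that by (auto simp: w_def Q_def)
        with poles[of q n] that show ?thesis by (simp only: g_def) simp
      qed
    qed
    ultimately have "a n \<le> (\<Sum>q\<in>Q. nat (- ord q f) + n * w q)" by linarith
    also have "\<dots> = B + n * W" by (simp add: sum.distrib B_def W_def sum_distrib_left)
    finally show ?thesis .
  qed

  have "W = (\<Sum>q\<in>S\<^sub>1 \<union> S\<^sub>2. w q)"
    unfolding W_def by (rule sum.mono_neutral_right) (use Q in \<open>auto simp: Q_def w_def\<close>)
  also have "\<dots> = (\<Sum>q\<in>S\<^sub>1. w q) + (\<Sum>q\<in>S\<^sub>2. w q)"
    by (rule sum.union_disjoint) (use fin1 fin2 disj in auto)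
  also have "(\<Sum>q\<in>S\<^sub>1. w q) = card S\<^sub>1"
    unfolding card_eq_sum by (rule sum.cong) (use disj in \<open>auto simp: w_def\<close>)
  finally have W: "W = card S\<^sub>1 + (\<Sum>q\<in>S\<^sub>2. w q)" .
  have "(\<Sum>q\<in>S\<^sub>2. val_at q (ddx \<iota> (t q) x) + 1) = (\<Sum>q\<in>S\<^sub>2. ereal (real (w q)))"
  proof (rule sum.cong)
    fix q assume q: "q \<in> S\<^sub>2"
    hence "0 < e q" "q \<in> C" using S2_iff sub by auto
    thus "val_at q (ddx \<iota> (t q) x) + 1 = ereal (real (w q))"
      using q by (simp add: val_dx w_def one_ereal_def)
  qed simp
  hence rhs: "ereal (real (card S\<^sub>1)) + (\<Sum>q\<in>S\<^sub>2. val_at q (ddx \<iota> (t q) x) + 1) = ereal (real W)"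
    by (simp add: W)

  have "limsup (\<lambda>n. ereal (real (a n) / real n)) \<le> limsup (\<lambda>n. ereal (real B / real n + real W))"
  proof (rule Limsup_mono, rule eventually_sequentiallyI[of 1])
    fix n :: nat assume "1 \<le> n"
    have "real (a n) \<le> real (B + n * W)" using bound by (simp only: of_nat_le_iff)
    hence "real (a n) \<le> real B + real n * real W" by simp
    thus "ereal (real (a n) / real n) \<le> ereal (real B / real n + real W)"
      using \<open>1 \<le> n\<close> by (simp add: field_simps)
  qed
  also have "(\<lambda>n. real B / real n + real W) \<longlonglongrightarrow> 0 + real W"
    by (intro tendsto_add tendsto_const lim_const_over_n)
  hence "(\<lambda>n. ereal (real B / real n + real W)) \<longlonglongrightarrow> ereal (real W)" by simp
  hence "limsup (\<lambda>n. ereal (real B / real n + real W)) = ereal (real W)"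
    by (intro lim_imp_Limsup) simp_all
  finally show ?thesis unfolding rhs .
qed

end
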